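(* Let $K$ be an algebraically closed field with $\operatorname{char}(K)=0$, let $n\geq 5$ be odd, and let $I\subset K[\mathbf{P}^2]$ be the radical ideal of any $n$ distinct points on a smooth plane conic. Let $M\subset K[\mathbf{P}^2]$ be the ideal generated by the variables. Then for all integers $m,t\geq 1$: (i) $I^{(t(m+1))}\subseteq M^{t}(I^{(m)})^t$; and (ii) $I^{(t(m+1)-1)}\subseteq (I^{(m)})^t$ and $I^{(t(m+1)-1)}\subseteq M^{t-1}(I^{(m)})^t$.
   Context: For distinct points $P_1,\ldots,P_n\in\mathbf{P}^2$ with radical ideal $I=\bigcap_i I(P_i)$, where $I(P_i)$ is the ideal generated by all forms vanishing at $P_i$, the $m$-th symbolic power is $I^{(m)}=\bigcap_i I(P_i)^m$. For any ideal $J$, $J^0$ is the whole ring. *)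

theory Defs
  imports
    "HOL-Analysis.Cartesian_Space"
    "HOL-Computational_Algebra.Polynomial"
    "HOL-Library.Poly_Mapping"
    "HOL-Algebra.Ideal_Product"
    "HOL-Algebra.Algebraic_Closure_Type"
begin

text \<open>The homogeneous coordinate ring \<open>K[P\<^sup>2]\<close>: the variables are indexed by the three-element
  type \<open>3\<close>, and \<open>3 \<Rightarrow>\<^sub>0 nat\<close> is the type of exponent vectors of monomials.\<close>

type_synonym 'k poly3 = "(3 \<Rightarrow>\<^sub>0 nat) \<Rightarrow>\<^sub>0 'k"

abbreviation coord_ring :: "'k::comm_ring_1 poly3 ring"
  where "coord_ring \<equiv> ring_of_type_algebra"

definition variable :: "3 \<Rightarrow> 'k::comm_ring_1 poly3"
  where "variable i = Poly_Mapping.single (Poly_Mapping.single i 1) 1"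

definition poly_eval :: "'k::comm_ring_1 poly3 \<Rightarrow> 'k ^ 3 \<Rightarrow> 'k"
  where "poly_eval F v =
    (\<Sum>a\<in>Poly_Mapping.keys F.
       Poly_Mapping.lookup F a * (\<Prod>i\<in>UNIV. (v $ i) ^ Poly_Mapping.lookup a i))"

definition homogeneous :: "nat \<Rightarrow> 'k::comm_ring_1 poly3 \<Rightarrow> bool"
  where "homogeneous d F \<longleftrightarrow>
    (\<forall>a\<in>Poly_Mapping.keys F. (\<Sum>i\<in>UNIV. Poly_Mapping.lookup a i) = d)"

text \<open>When the exponent of the \<open>i\<close>-th variable is \<open>0\<close>, the exponent subtraction truncates, but
  the resulting term has coefficient \<open>0\<close>.\<close>

definition partial_deriv :: "3 \<Rightarrow> 'k::comm_ring_1 poly3 \<Rightarrow> 'k poly3"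
  where "partial_deriv i F =
    (\<Sum>a\<in>Poly_Mapping.keys F.
       Poly_Mapping.single (a - Poly_Mapping.single i 1)
         (of_nat (Poly_Mapping.lookup a i) * Poly_Mapping.lookup F a))"

text \<open>A point of the projective plane is a line through the origin of \<open>K\<^sup>3\<close>; a form vanishes at a
  point if it vanishes at all homogeneous coordinate vectors of the point. (The line
  also contains the vector \<open>0\<close>. At \<open>0\<close> a form of positive degree is zero, and a form of degree zero
  is constant on the whole line, so including \<open>0\<close> makes no difference.)\<close>

definition proj_plane :: "('k::field ^ 3) set set"
  where "proj_plane = {P. vec.subspace P \<and> vec.dim P = 1}"

definition vanishes_at :: "'k::field poly3 \<Rightarrow> ('k ^ 3) set \<Rightarrow> bool"
  where "vanishes_at F P \<longleftrightarrow> (\<forall>v\<in>P. poly_eval F v = 0)"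

definition smooth_conic :: "('k::field ^ 3) set set \<Rightarrow> bool"
  where "smooth_conic C \<longleftrightarrow>
    (\<exists>Q. Q \<noteq> 0 \<and> homogeneous 2 Q \<and>
         C = {P \<in> proj_plane. vanishes_at Q P} \<and>
         (\<forall>P\<in>C. \<exists>i. \<not> vanishes_at (partial_deriv i Q) P))"

definition irrelevant_ideal :: "'k::field poly3 set"
  where "irrelevant_ideal = genideal coord_ring (range variable)"

definition point_ideal :: "('k::field ^ 3) set \<Rightarrow> 'k poly3 set"
  where "point_ideal P = genideal coord_ring {F. (\<exists>d. homogeneous d F) \<and> vanishes_at F P}"

definition radical_ideal :: "('k::field ^ 3) set set \<Rightarrow> 'k poly3 set"
  where "radical_ideal S = (\<Inter>P\<in>S. point_ideal P)"

text \<open>Powers in the monoid of ideals under multiplication of ideals; the zeroth power is the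
  whole ring.\<close>

abbreviation ideal_power :: "'k::field poly3 set \<Rightarrow> nat \<Rightarrow> 'k poly3 set"
  where "ideal_power J m \<equiv> J [^]\<^bsub>ideals_set coord_ring\<^esub> m"

text \<open>The \<open>m\<close>-th symbolic power of \<open>radical_ideal S\<close>, for a nonempty finite set \<open>S\<close> of points.\<close>

definition symbolic_power :: "('k::field ^ 3) set set \<Rightarrow> nat \<Rightarrow> 'k poly3 set"
  where "symbolic_power S m = (\<Inter>P\<in>S. ideal_power (point_ideal P) m)"

lemma ideal_irrelevant_ideal: "ideal (irrelevant_ideal :: 'k::field poly3 set) coord_ring"
proof -
  interpret cring "coord_ring :: 'k poly3 ring" by (rule cring_from_type_algebra)
  show ?thesis
    unfolding irrelevant_ideal_def by (rule genideal_ideal) (simp add: ring_of_type_algebra_def)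
qed

lemma ideal_point_ideal: "ideal (point_ideal P) coord_ring"
proof -
  interpret cring "coord_ring :: 'a poly3 ring" by (rule cring_from_type_algebra)
  show ?thesis
    unfolding point_ideal_def by (rule genideal_ideal) (simp add: ring_of_type_algebra_def)
qed

lemma ideal_power_0: "ideal_power J 0 = UNIV"
  by (simp add: ideals_set_def ring_of_type_algebra_def)

lemma ideal_power_Suc: "ideal_power J (Suc m) = ideal_power J m \<cdot>\<^bsub>coord_ring\<^esub> J"
  by (simp add: ideals_set_def)

lemma ideal_power_1:
  assumes "ideal J coord_ring"
  shows "ideal_power J 1 = J"
proof -
  interpret cring "coord_ring :: 'a poly3 ring" by (rule cring_from_type_algebra)
  have "carrier coord_ring \<cdot>\<^bsub>coord_ring\<^esub> J = J \<cdot>\<^bsub>coord_ring\<^esub> carrier coord_ring"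
    by (rule ideal_prod_commute[OF oneideal assms])
  then show ?thesis
    using ideal_prod_one[OF assms] by (simp add: ideals_set_def)
qed

lemma symbolic_power_1: "symbolic_power S 1 = radical_ideal S"
  unfolding symbolic_power_def radical_ideal_def
  by (intro INF_cong refl ideal_power_1 ideal_point_ideal)

end

theory Submission
  imports Defs
begin

text \<open>
  Choose linear coordinates in which the conic is \<open>Q = X Z - Y\<^sup>2\<close> and none of the points is at infinity,
  so that \<open>(1 : \<tau> : \<tau>\<^sup>2)\<close> parametrises it and the points are \<open>\<tau>\<^sub>0, \<dots>, \<tau>\<^sub>2\<^sub>l\<close>. Restricting forms to the
  conic has kernel \<open>(Q)\<close>, and a form in \<open>I\<^sup>(\<^sup>N\<^sup>)\<close> restricts to a multiple of \<open>p\<^sup>N\<close>, where \<open>p\<close> is the product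
  of the \<open>t - \<tau>\<^sub>i\<close>. The closed polygon \<open>P \<in> I\<^sup>(\<^sup>2\<^sup>)\<close> through the points restricts to \<open>p\<^sup>2\<close>; a matching of
  all points but one, completed by a line through the last point and infinity or \<open>0\<close>, gives
  \<open>A, B \<in> I\<close> restricting to \<open>p\<close> and \<open>t p\<close>. Since \<open>Q G \<in> I\<^sup>(\<^sup>N\<^sup>+\<^sup>1\<^sup>)\<close> implies \<open>G \<in> I\<^sup>(\<^sup>N\<^sup>)\<close>, induction on \<open>N\<close>
  shows that \<open>I\<^sup>(\<^sup>N\<^sup>)\<close> is generated by the monomials \<open>Q\<^sup>a P\<^sup>b E\<close>, \<open>E \<in> {1, A, B}\<close>, of weight \<open>N\<close>, where
  \<open>Q, A, B\<close> have weight 1 and \<open>P\<close> has weight 2. Such a monomial has a factor of the same kind of every even weight \<open>\<le> N\<close>.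
  Splitting off weight \<open>m\<close> repeatedly settles even \<open>m\<close>, the remaining weight lying in a power of \<open>M\<close>;
  for odd \<open>m\<close> one splits off weight \<open>m + 1\<close>, and such monomials lie in \<open>M I\<^sup>(\<^sup>m\<^sup>)\<close>.
\<close>

section \<open>Ideals of a commutative ring given by a type class\<close>

lemma coord_ring_simps [simp]:
  "carrier (ring_of_type_algebra :: 'a::comm_ring_1 ring) = UNIV"
  "x \<otimes>\<^bsub>(ring_of_type_algebra :: 'a ring)\<^esub> y = x * y"
  "x \<oplus>\<^bsub>(ring_of_type_algebra :: 'a ring)\<^esub> y = x + y"
  "\<one>\<^bsub>(ring_of_type_algebra :: 'a ring)\<^esub> = 1"
  "\<zero>\<^bsub>(ring_of_type_algebra :: 'a ring)\<^esub> = 0"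
  by (simp_all add: ring_of_type_algebra_def)

abbreviation is_ideal :: "'a::comm_ring_1 set \<Rightarrow> bool"
  where "is_ideal J \<equiv> ideal J ring_of_type_algebra"

abbreviation gen_ideal :: "'a::comm_ring_1 set \<Rightarrow> 'a set"
  where "gen_ideal \<equiv> genideal ring_of_type_algebra"

lemma is_idealI:
  fixes J :: "'a::comm_ring_1 set"
  assumes z: "0 \<in> J" and a: "\<And>x y. x \<in> J \<Longrightarrow> y \<in> J \<Longrightarrow> x + y \<in> J"
    and m: "\<And>x r. x \<in> J \<Longrightarrow> r * x \<in> J"
  shows "is_ideal J"
proof -
  interpret cring "ring_of_type_algebra :: 'a ring" by (rule cring_from_type_algebra)
  have inv: "inv\<^bsub>add_monoid ring_of_type_algebra\<^esub> x = - x" for x :: 'a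
    using minus_equality[of "- x" x] by (simp add: a_inv_def)
  have neg: "- x \<in> J" if "x \<in> J" for x
    using m[OF that, of "- 1"] by simp
  show ?thesis
  proof (rule idealI)
    show "ring (ring_of_type_algebra :: 'a ring)" ..
    show "subgroup J (add_monoid ring_of_type_algebra)"
      unfolding subgroup_def inv using z a neg by simp
  qed (use m in \<open>simp_all add: mult.commute\<close>)
qed

lemma ideal_0_mem: "is_ideal J \<Longrightarrow> 0 \<in> J"
  using additive_subgroup.zero_closed[OF ideal.axioms(1), of J ring_of_type_algebra] by simp

lemma ideal_add: "is_ideal J \<Longrightarrow> x \<in> J \<Longrightarrow> y \<in> J \<Longrightarrow> x + y \<in> J"
  using additive_subgroup.a_closed[OF ideal.axioms(1), of J ring_of_type_algebra] by simp

lemma ideal_mult_left: "is_ideal J \<Longrightarrow> x \<in> J \<Longrightarrow> r * x \<in> J"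
  using ideal.I_l_closed[of J ring_of_type_algebra x r] by simp

lemma ideal_mult_right: "is_ideal J \<Longrightarrow> x \<in> J \<Longrightarrow> x * r \<in> J"
  using ideal_mult_left[of J x r] by (simp add: mult.commute)

lemma ideal_uminus: "is_ideal J \<Longrightarrow> x \<in> J \<Longrightarrow> - x \<in> J"
  using ideal_mult_left[of J x "- 1"] by simp

lemma ideal_diff: "is_ideal J \<Longrightarrow> x \<in> J \<Longrightarrow> y \<in> J \<Longrightarrow> x - y \<in> J"
  using ideal_add[of J x "- y"] ideal_uminus[of J y] by simp

lemma ideal_sum: "is_ideal J \<Longrightarrow> (\<And>i. i \<in> A \<Longrightarrow> f i \<in> J) \<Longrightarrow> sum f A \<in> J"
  by (induction A rule: infinite_finite_induct) (auto simp: ideal_0_mem ideal_add)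

lemma is_ideal_UNIV: "is_ideal (UNIV :: 'a::comm_ring_1 set)"
  by (rule is_idealI) auto

lemma is_ideal_prod:
  fixes I J :: "'a::comm_ring_1 set"
  assumes "is_ideal I" "is_ideal J"
  shows "is_ideal (I \<cdot>\<^bsub>ring_of_type_algebra\<^esub> J)"
  by (rule ring.ideal_prod_is_ideal[OF ring_from_type_algebra assms])

lemma ideal_prod_memI:
  fixes I J :: "'a::comm_ring_1 set"
  shows "x \<in> I \<Longrightarrow> y \<in> J \<Longrightarrow> x * y \<in> I \<cdot>\<^bsub>ring_of_type_algebra\<^esub> J"
  using ideal_prod.prod[of x I y J ring_of_type_algebra] by simp

lemma ideal_prod_subsetI:
  fixes I J T :: "'a::comm_ring_1 set"
  assumes "is_ideal T" "\<And>x y. x \<in> I \<Longrightarrow> y \<in> J \<Longrightarrow> x * y \<in> T"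
  shows "I \<cdot>\<^bsub>ring_of_type_algebra\<^esub> J \<subseteq> T"
proof
  fix z assume "z \<in> I \<cdot>\<^bsub>ring_of_type_algebra\<^esub> J"
  then show "z \<in> T"
    by induction (use assms in \<open>auto simp: ideal_add\<close>)
qed

text \<open>This is the colon ideal of \<open>T\<close> by \<open>r\<close>. It lets a statement
  that \<open>r\<close> multiplies an ideal into \<open>T\<close> be checked on generators or on
  products only.\<close>

lemma is_ideal_colon:
  fixes T :: "'a::comm_ring_1 set"
  shows "is_ideal T \<Longrightarrow> is_ideal {x. r * x \<in> T}"
  by (rule is_idealI) (simp_all add: ideal_0_mem ideal_add distrib_left ideal_mult_left mult.left_commute[of r])

lemma is_ideal_gen: "is_ideal (gen_ideal (G :: 'a::comm_ring_1 set))"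
  by (rule ring.genideal_ideal[OF ring_from_type_algebra]) simp

lemma gen_ideal_mem: "x \<in> G \<Longrightarrow> x \<in> gen_ideal (G :: 'a::comm_ring_1 set)"
  using ring.genideal_self[OF ring_from_type_algebra, of G] by auto

lemma gen_ideal_subsetI: "is_ideal T \<Longrightarrow> G \<subseteq> T \<Longrightarrow> gen_ideal G \<subseteq> (T :: 'a::comm_ring_1 set)"
  by (rule ring.genideal_minimal[OF ring_from_type_algebra])

section \<open>Powers of ideals and symbolic powers\<close>

lemma is_ideal_power:
  assumes "is_ideal J"
  shows "is_ideal (ideal_power J m)"
proof (induction m)
  case 0
  show ?case unfolding ideal_power_0 by (rule is_ideal_UNIV)
next
  case (Suc m)
  then show ?case unfolding ideal_power_Suc by (rule is_ideal_prod[OF _ assms])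
qed

lemma ideal_power_mult_mem:
  assumes J: "is_ideal J" and "x \<in> ideal_power J a" "y \<in> ideal_power J b"
  shows "x * y \<in> ideal_power J (a + b)"
proof -
  interpret cring "coord_ring :: 'a poly3 ring" by (rule cring_from_type_algebra)
  interpret I: comm_monoid "ideals_set (coord_ring :: 'a poly3 ring)"
    by (rule ideals_set_is_comm_monoid)
  have "ideal_power J a \<cdot>\<^bsub>coord_ring\<^esub> ideal_power J b = ideal_power J (a + b)"
    using I.nat_pow_mult[of J a b] J by (simp add: ideals_set_def)
  then show ?thesis
    using ideal_prod_memI[OF assms(2,3)] by simp
qed

lemma ideal_power_1_mem: "is_ideal J \<Longrightarrow> x \<in> J \<Longrightarrow> x \<in> ideal_power J 1"
  by (simp only: ideal_power_1)

lemma ideal_power_pow_mem: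
  assumes "is_ideal J" "x \<in> ideal_power J a"
  shows "x ^ k \<in> ideal_power J (a * k)"
proof (induction k)
  case 0
  show ?case by (simp only: mult_0_right ideal_power_0 UNIV_I)
next
  case (Suc k)
  from ideal_power_mult_mem[OF assms Suc] show ?case by simp
qed

lemma ideal_power_mono:
  assumes J: "is_ideal J" and "a \<le> b"
  shows "ideal_power J b \<subseteq> ideal_power J a"
  using \<open>a \<le> b\<close>
proof (induction b rule: dec_induct)
  case (step n)
  have "ideal_power J (Suc n) \<subseteq> ideal_power J n"
    unfolding ideal_power_Suc
    by (rule ideal_prod_subsetI[OF is_ideal_power[OF J]]) (rule ideal_mult_right[OF is_ideal_power[OF J]])
  with step show ?case by blast
qed simp

text \<open>The powers of \<open>J\<close> form the smallest family of ideals that starts with the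
  whole ring and absorbs one factor from \<open>J\<close> per step. This bounds them from above by
  divisibility conditions.\<close>

lemma ideal_power_induct [consumes 1, case_names ideal one step]:
  assumes "F \<in> ideal_power J m"
    and "\<And>k. is_ideal (T k)" and "T 0 = UNIV"
    and step: "\<And>k x y. x \<in> T k \<Longrightarrow> y \<in> J \<Longrightarrow> x * y \<in> T (Suc k)"
  shows "F \<in> T m"
proof -
  have "ideal_power J k \<subseteq> T k" for k
  proof (induction k)
    case 0
    show ?case using assms(3) by simp
  next
    case (Suc k)
    then show ?case
      unfolding ideal_power_Suc by (intro ideal_prod_subsetI assms(2)) (blast intro: step)
  qed
  with assms(1) show ?thesis by blast
qed

lemma is_ideal_symbolic_power: "is_ideal (symbolic_power S m)"
  unfolding symbolic_power_def
  by (rule is_idealI)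
     (auto intro: ideal_0_mem ideal_add ideal_mult_left is_ideal_power ideal_point_ideal)

lemma symbolic_power_mult_mem:
  "x \<in> symbolic_power S a \<Longrightarrow> y \<in> symbolic_power S b \<Longrightarrow> x * y \<in> symbolic_power S (a + b)"
  unfolding symbolic_power_def by (auto intro: ideal_power_mult_mem ideal_point_ideal)

lemma symbolic_power_pow_mem:
  "x \<in> symbolic_power S a \<Longrightarrow> x ^ k \<in> symbolic_power S (a * k)"
  unfolding symbolic_power_def by (auto intro: ideal_power_pow_mem ideal_point_ideal)

section \<open>Substitution into ternary polynomials\<close>

abbreviation cst :: "'k::comm_ring_1 \<Rightarrow> 'k poly3"
  where "cst \<equiv> Poly_Mapping.single 0"

text \<open>The evaluation homomorphism of the polynomial ring into any commutative ring. Evaluation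
  at a vector, the scaling \<open>theta\<close> and the restriction \<open>rho\<close> to the conic
  are all instances.\<close>

definition subst :: "('k::comm_ring_1 \<Rightarrow> 'a::comm_ring_1) \<Rightarrow> (3 \<Rightarrow> 'a) \<Rightarrow> 'k poly3 \<Rightarrow> 'a"
  where "subst h x F = (\<Sum>a\<in>Poly_Mapping.keys F.
    h (Poly_Mapping.lookup F a) * (\<Prod>i\<in>UNIV. x i ^ Poly_Mapping.lookup a i))"

lemma poly_eval_subst: "poly_eval F v = subst (\<lambda>c. c) (\<lambda>i. v $ i) F"
  by (simp add: poly_eval_def subst_def)

lemma prod_power_lookup_single:
  "(\<Prod>j\<in>UNIV. x j ^ Poly_Mapping.lookup (Poly_Mapping.single i (1::nat)) j) = (x (i :: 3) :: 'k::comm_ring_1)"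
proof -
  have "(\<Prod>j\<in>UNIV. x j ^ Poly_Mapping.lookup (Poly_Mapping.single i (1::nat)) j) = (\<Prod>j\<in>UNIV. if i = j then x i else 1)"
    by (rule prod.cong) (auto simp: lookup_single when_def)
  then show ?thesis by simp
qed

locale coeff_hom =
  fixes h :: "'k::comm_ring_1 \<Rightarrow> 'a::comm_ring_1"
  assumes h0: "h 0 = 0" and h1: "h 1 = 1" and hadd: "h (a + b) = h a + h b"
    and hmult: "h (a * b) = h a * h b"
begin

lemma subst_superset:
  assumes "finite A" "Poly_Mapping.keys F \<subseteq> A"
  shows "subst h x F = (\<Sum>a\<in>A. h (Poly_Mapping.lookup F a) * (\<Prod>i\<in>UNIV. x i ^ Poly_Mapping.lookup a i))"
  unfolding subst_def by (rule sum.mono_neutral_left) (use assms h0 in \<open>auto simp: in_keys_iff\<close>)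

lemma subst_add: "subst h x (F + G) = subst h x F + subst h x G"
proof -
  let ?A = "Poly_Mapping.keys F \<union> Poly_Mapping.keys G"
  have *: "finite ?A" "Poly_Mapping.keys (F + G) \<subseteq> ?A" "Poly_Mapping.keys F \<subseteq> ?A" "Poly_Mapping.keys G \<subseteq> ?A"
    using Poly_Mapping.keys_add[of F G] by auto
  show ?thesis
    unfolding subst_superset[OF *(1,2)] subst_superset[OF *(1,3)] subst_superset[OF *(1,4)]
    by (simp add: lookup_add hadd sum.distrib algebra_simps)
qed

lemma subst_0: "subst h x 0 = 0"
  by (simp add: subst_def)

lemma subst_sum: "subst h x (sum f A) = (\<Sum>i\<in>A. subst h x (f i))"
  by (induction A rule: infinite_finite_induct) (simp_all add: subst_0 subst_add)

lemma subst_single: "subst h x (Poly_Mapping.single a c) = h c * (\<Prod>i\<in>UNIV. x i ^ Poly_Mapping.lookup a i)"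
  using h0 by (simp add: subst_def)

lemma subst_cst: "subst h x (cst c) = h c"
  by (simp add: subst_single)

lemma subst_1: "subst h x 1 = 1"
  using subst_cst[of x 1] h1 by simp

lemma subst_variable: "subst h x (variable i) = x i"
  by (simp add: variable_def subst_single h1 prod_power_lookup_single[unfolded One_nat_def])

end

lemma poly3_expand: "F = (\<Sum>a\<in>Poly_Mapping.keys F. Poly_Mapping.single a (Poly_Mapping.lookup F a))"
proof (rule poly_mapping_eqI)
  fix b
  have "(\<Sum>a\<in>Poly_Mapping.keys F. Poly_Mapping.lookup (Poly_Mapping.single a (Poly_Mapping.lookup F a)) b)
      = (\<Sum>a\<in>Poly_Mapping.keys F. if a = b then Poly_Mapping.lookup F b else 0)"
    by (rule sum.cong) (auto simp: lookup_single when_def)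
  then show "Poly_Mapping.lookup F b = Poly_Mapping.lookup (\<Sum>a\<in>Poly_Mapping.keys F. Poly_Mapping.single a (Poly_Mapping.lookup F a)) b"
    by (simp add: lookup_sum in_keys_iff)
qed

context coeff_hom
begin

lemma subst_mult: "subst h x (F * G) = subst h x F * subst h x G"
proof -
  let ?m = "\<lambda>a c. Poly_Mapping.single a c"
  have ss: "subst h x (?m a c * ?m b d) = subst h x (?m a c) * subst h x (?m b d)" for a b c d
    by (simp add: mult_single subst_single hmult lookup_add power_add prod.distrib algebra_simps)
  have "subst h x (F * G) = subst h x ((\<Sum>a\<in>Poly_Mapping.keys F. ?m a (Poly_Mapping.lookup F a)) *
      (\<Sum>a\<in>Poly_Mapping.keys G. ?m a (Poly_Mapping.lookup G a)))"
    by (simp only: poly3_expand[symmetric])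
  also have "\<dots> = subst h x (\<Sum>a\<in>Poly_Mapping.keys F. ?m a (Poly_Mapping.lookup F a)) *
      subst h x (\<Sum>a\<in>Poly_Mapping.keys G. ?m a (Poly_Mapping.lookup G a))"
    by (simp only: sum_product subst_sum ss)
  finally show ?thesis by (simp only: poly3_expand[symmetric])
qed

lemma subst_power: "subst h x (F ^ k) = subst h x F ^ k"
  by (induction k) (simp_all add: subst_1 subst_mult)

lemma subst_prod: "subst h x (prod f A) = (\<Prod>i\<in>A. subst h x (f i))"
  by (induction A rule: infinite_finite_induct) (simp_all add: subst_1 subst_mult)

lemma subst_diff: "subst h x (F - G) = subst h x F - subst h x G"
  using subst_add[of x "F - G" G] by simp

lemmas subst_simps = subst_0 subst_1 subst_add subst_diff subst_mult subst_power subst_prod subst_sum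
  subst_cst subst_variable

end

lemma coeff_hom_cst: "coeff_hom (cst :: 'k::comm_ring_1 \<Rightarrow> _)"
  by unfold_locales (simp_all add: single_add mult_single)

lemma coeff_hom_id: "coeff_hom (\<lambda>c :: 'k::comm_ring_1. c)"
  by unfold_locales simp_all

lemma single_eq_monomial:
  "Poly_Mapping.single a c = cst c * (\<Prod>i\<in>UNIV. variable i ^ Poly_Mapping.lookup a i)"
  for c :: "'k::comm_ring_1"
proof -
  have pow: "variable i ^ k = (Poly_Mapping.single (Poly_Mapping.single i k) 1 :: 'k poly3)" for i k
    by (induction k) (simp_all add: variable_def mult_single flip: single_add)
  have pr: "(\<Prod>i\<in>A. Poly_Mapping.single (f i) 1) = (Poly_Mapping.single (\<Sum>i\<in>A. f i) 1 :: 'k poly3)"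
    if "finite A" for A :: "3 set" and f
    using that by (induction A) (simp_all add: mult_single)
  have "(\<Sum>i\<in>UNIV. Poly_Mapping.single i (Poly_Mapping.lookup a i)) = a"
  proof (rule poly_mapping_eqI)
    fix j
    have "(\<Sum>i\<in>UNIV. Poly_Mapping.lookup (Poly_Mapping.single i (Poly_Mapping.lookup a i)) j)
        = (\<Sum>i\<in>UNIV. if i = j then Poly_Mapping.lookup a j else 0)"
      by (rule sum.cong) (auto simp: lookup_single when_def)
    then show "Poly_Mapping.lookup (\<Sum>i\<in>UNIV. Poly_Mapping.single i (Poly_Mapping.lookup a i)) j = Poly_Mapping.lookup a j"
      by (simp add: lookup_sum)
  qed
  then show ?thesis by (simp add: pow pr mult_single)
qed

text \<open>Monomials arise from constants by repeated multiplication by variables, so a property of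
  all polynomials needs a check only on constants, sums and one further variable.\<close>

lemma poly3_induct [case_names cst add variable]:
  fixes F :: "'k::comm_ring_1 poly3"
  assumes c: "\<And>c. P (cst c)" and add: "\<And>F G. P F \<Longrightarrow> P G \<Longrightarrow> P (F + G)"
    and var: "\<And>i F. P F \<Longrightarrow> P (variable i * F)"
  shows "P F"
proof -
  have pow: "P (variable i ^ k * F)" if "P F" for i k F
    by (induction k) (simp_all add: that var mult.assoc)
  have pr: "P ((\<Prod>i\<in>A. variable i ^ f i) * F)" if "finite A" "P F" for A :: "3 set" and f F
    using that(1) by (induction A) (simp_all add: that pow mult.assoc)
  have "P (Poly_Mapping.single a c)" for a c
    using pr[where A = UNIV and F = "cst c" and f = "Poly_Mapping.lookup a", OF finite c]
    by (simp only: single_eq_monomial[of a c] mult.commute[of "cst c"])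
  moreover have "P 0" using c[of 0] by simp
  ultimately have "P (\<Sum>a\<in>A. Poly_Mapping.single a (f a))" for A f
    by (induction A rule: infinite_finite_induct) (simp_all add: add)
  then show ?thesis by (subst poly3_expand) blast
qed

section \<open>Linear coordinates adapted to a conic\<close>

lemma cst_hom_simps:
  "cst 0 = (0 :: 'k::comm_ring_1 poly3)"
  "cst 1 = (1 :: 'k poly3)"
  "cst (a + b) = cst a + (cst b :: 'k poly3)"
  "cst (a - b) = cst a - (cst b :: 'k poly3)"
  "cst (- a) = - (cst a :: 'k poly3)"
  "cst (a * b) = cst a * (cst b :: 'k poly3)"
  by (simp_all add: single_add mult_single single_diff single_uminus)

lemma cst_power: "cst (a ^ k) = (cst a :: 'k::comm_ring_1 poly3) ^ k"
  by (induction k) (simp_all add: cst_hom_simps)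

lemma cst_prod: "cst (prod f A) = (\<Prod>i\<in>A. cst (f i) :: 'k::comm_ring_1 poly3)"
  by (induction A rule: infinite_finite_induct) (simp_all add: cst_hom_simps)

lemma cst_sum: "cst (sum f A) = (\<Sum>i\<in>A. cst (f i) :: 'k::comm_ring_1 poly3)"
  by (induction A rule: infinite_finite_induct) (simp_all add: cst_hom_simps)

lemma subst_cst_variable: "subst cst variable F = F"
proof -
  interpret coeff_hom "cst :: 'a \<Rightarrow> _" by (rule coeff_hom_cst)
  show ?thesis by (induction F rule: poly3_induct) (simp_all add: subst_simps)
qed

definition lin :: "'k::comm_ring_1 ^ 3 \<Rightarrow> 'k poly3"
  where "lin a = (\<Sum>i\<in>UNIV. cst (a $ i) * variable i)"

definition dot :: "'k::comm_ring_1 ^ 3 \<Rightarrow> 'k ^ 3 \<Rightarrow> 'k"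
  where "dot a b = (\<Sum>i\<in>UNIV. a $ i * b $ i)"

lemma dot_simps:
  "dot (a + b) c = dot a c + dot b c" "dot (a - b) c = dot a c - dot b c"
  "dot c (a + b) = dot c a + dot c b" "dot c (a - b) = dot c a - dot c b"
  "dot (r *s a) b = r * dot a b" "dot a (r *s b) = r * dot a b"
  by (simp_all add: dot_def algebra_simps sum.distrib sum_subtractf sum_distrib_left)

lemma lin_simps:
  "lin (a + b) = lin a + lin b" "lin (a - b) = lin a - lin b" "lin (r *s a) = cst r * lin a"
  by (simp_all add: lin_def algebra_simps cst_hom_simps sum.distrib sum_subtractf sum_distrib_left)

lemma homogeneous_lin: "homogeneous 1 (lin a)"
  unfolding homogeneous_def
proof
  fix b assume b: "b \<in> Poly_Mapping.keys (lin a)"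
  have "Poly_Mapping.keys (lin a) \<subseteq> (\<Union>i. Poly_Mapping.keys (cst (a $ i) * variable i))"
    unfolding lin_def by (rule keys_sum)
  also have "\<dots> \<subseteq> (\<Union>i. {Poly_Mapping.single i 1})"
    by (auto simp: variable_def mult_single split: if_splits)
  finally obtain i where "b = Poly_Mapping.single i 1"
    using b by blast
  then show "(\<Sum>j\<in>UNIV. Poly_Mapping.lookup b j) = 1"
    by (simp add: lookup_single when_def)
qed

lemma (in coeff_hom) subst_lin: "subst h x (lin a) = (\<Sum>i\<in>UNIV. h (a $ i) * x i)"
  by (simp add: lin_def subst_simps)

lemma (in coeff_hom) h_sum: "h (sum f A) = (\<Sum>i\<in>A. h (f i))"
  by (induction A rule: infinite_finite_induct) (simp_all add: h0 hadd)

lemma poly_eval_lin: "poly_eval (lin a) v = dot a v"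
  using coeff_hom.subst_lin[OF coeff_hom_id, of "\<lambda>i. v $ i" a] by (simp add: poly_eval_subst dot_def)

text \<open>Congruent arguments give congruent values modulo \<open>J\<close>. The step for a
  variable uses a b - c d = a (b - d) + (a - c) d.\<close>

lemma subst_cst_cong_ideal:
  assumes J: "is_ideal J" and "\<And>i. x i - y i \<in> J"
  shows "subst cst x F - subst cst y F \<in> J"
proof -
  interpret coeff_hom "cst :: 'a \<Rightarrow> _" by (rule coeff_hom_cst)
  show ?thesis
  proof (induction F rule: poly3_induct)
    case (cst c)
    show ?case using J by (simp add: subst_simps ideal_0_mem)
  next
    case (add F G)
    then show ?case
      using ideal_add[OF J] by (fastforce simp: subst_simps algebra_simps)
  next
    case (variable i F)
    have "x i * (subst cst x F - subst cst y F) + (x i - y i) * subst cst y F \<in> J"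
      by (intro ideal_add ideal_mult_left ideal_mult_right J variable assms(2))
    then show ?case by (simp add: subst_simps algebra_simps)
  qed
qed

text \<open>Each monomial of a form contributes the same power of \<open>LX\<close>, so the value of
  the form at \<open>u\<close> factors out. A form vanishing at \<open>u\<close> is thereby
  killed.\<close>

lemma subst_point_homogeneous:
  assumes "homogeneous d F"
  shows "subst cst (\<lambda>i. cst (u $ i) * LX) F = cst (poly_eval F u) * LX ^ d"
proof -
  have "subst cst (\<lambda>i. cst (u $ i) * LX) F =
    (\<Sum>a\<in>Poly_Mapping.keys F. cst (Poly_Mapping.lookup F a) * (\<Prod>i\<in>UNIV. cst ((u $ i) ^ Poly_Mapping.lookup a i)) * LX ^ d)"
    unfolding subst_def
  proof (rule sum.cong[OF refl])
    fix a assume "a \<in> Poly_Mapping.keys F"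
    then have "(\<Sum>i\<in>UNIV. Poly_Mapping.lookup a i) = d" using assms by (simp add: homogeneous_def)
    then have "(\<Prod>i\<in>UNIV. (cst (u $ i) * LX) ^ Poly_Mapping.lookup a i)
        = (\<Prod>i\<in>UNIV. cst ((u $ i) ^ Poly_Mapping.lookup a i)) * LX ^ d"
      by (simp add: power_mult_distrib prod.distrib cst_power flip: power_sum)
    then show "cst (Poly_Mapping.lookup F a) * (\<Prod>i\<in>UNIV. (cst (u $ i) * LX) ^ Poly_Mapping.lookup a i)
        = cst (Poly_Mapping.lookup F a) * (\<Prod>i\<in>UNIV. cst ((u $ i) ^ Poly_Mapping.lookup a i)) * LX ^ d"
      by simp
  qed
  then show ?thesis
    by (simp add: poly_eval_def cst_sum cst_hom_simps cst_prod sum_distrib_right)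
qed

text \<open>A basis with its dual basis: \<open>dual\<close> evaluates the coordinate forms on the
  frame, \<open>resolution\<close> writes the identity matrix in terms of it. In these coordinates
  \<open>u\<close> is (1:0:0) and \<open>w\<close> is (0:0:1), the point of the conic X Z = Y^2
  called infinity.\<close>

locale conic_frame =
  fixes u v w \<xi> \<eta> \<zeta> :: "'k::field ^ 3"
  assumes dual: "dot \<xi> u = 1" "dot \<xi> v = 0" "dot \<xi> w = 0"
      "dot \<eta> u = 0" "dot \<eta> v = 1" "dot \<eta> w = 0"
      "dot \<zeta> u = 0" "dot \<zeta> v = 0" "dot \<zeta> w = 1"
    and resolution: "u $ i * \<xi> $ j + v $ i * \<eta> $ j + w $ i * \<zeta> $ j = (if i = j then 1 else 0)"
begin

definition "LX = lin \<xi>"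
definition "LY = lin \<eta>"
definition "LZ = lin \<zeta>"
definition "Q = LX * LZ - LY * LY"

text \<open>Substitution of the vector with frame coordinates \<open>a\<close>, \<open>b\<close>,
  \<open>c\<close>, so that \<open>LX\<close>, \<open>LY\<close>, \<open>LZ\<close> go to exactly
  these values.\<close>

definition fsub :: "('k \<Rightarrow> 'b::comm_ring_1) \<Rightarrow> 'b \<Rightarrow> 'b \<Rightarrow> 'b \<Rightarrow> 'k poly3 \<Rightarrow> 'b"
  where "fsub h a b c = subst h (\<lambda>j. h (u $ j) * a + h (v $ j) * b + h (w $ j) * c)"

lemma variable_eq: "variable j = cst (u $ j) * LX + cst (v $ j) * LY + cst (w $ j) * LZ"
proof -
  have "cst (u $ j) * LX + cst (v $ j) * LY + cst (w $ j) * LZ =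
    (\<Sum>i\<in>UNIV. cst (u $ j * \<xi> $ i + v $ j * \<eta> $ i + w $ j * \<zeta> $ i) * variable i)"
    by (simp add: LX_def LY_def LZ_def lin_def sum_distrib_left sum.distrib cst_hom_simps algebra_simps)
  also have "\<dots> = (\<Sum>i\<in>UNIV. if j = i then variable j else 0)"
    unfolding resolution by (rule sum.cong) (auto simp: cst_hom_simps)
  finally show ?thesis by simp
qed

context
  fixes h :: "'k \<Rightarrow> 'b::comm_ring_1"
  assumes h: "coeff_hom h"
begin

interpretation coeff_hom h by (rule h)

lemma fsub_lin: "fsub h a b c (lin \<alpha>) = h (dot \<alpha> u) * a + h (dot \<alpha> v) * b + h (dot \<alpha> w) * c"
  unfolding fsub_def subst_lin dot_def h_sum hmult
  by (simp add: algebra_simps sum.distrib sum_distrib_left)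

lemma fsub_coords: "fsub h a b c LX = a" "fsub h a b c LY = b" "fsub h a b c LZ = c"
  by (simp_all add: LX_def LY_def LZ_def fsub_lin dual h0 h1)

lemma fsub_hom:
  "fsub h a b c 0 = 0" "fsub h a b c 1 = 1" "fsub h a b c (F + G) = fsub h a b c F + fsub h a b c G"
  "fsub h a b c (F - G) = fsub h a b c F - fsub h a b c G"
  "fsub h a b c (F * G) = fsub h a b c F * fsub h a b c G"
  "fsub h a b c (F ^ k) = fsub h a b c F ^ k"
  "fsub h a b c (prod f A) = (\<Prod>i\<in>A. fsub h a b c (f i))"
  "fsub h a b c (sum f A) = (\<Sum>i\<in>A. fsub h a b c (f i))"
  "fsub h a b c (cst r) = h r"
  "fsub h a b c (variable j) = h (u $ j) * a + h (v $ j) * b + h (w $ j) * c"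
  unfolding fsub_def by (simp_all add: subst_simps)

end

lemma coords_nonzero: "LX \<noteq> 0" "LZ \<noteq> 0"
proof -
  note f = fsub_coords[OF coeff_hom_id, of 1 0 1] fsub_hom[OF coeff_hom_id, of 1 0 1]
  show "LX \<noteq> 0" using f by (metis zero_neq_one)
  show "LZ \<noteq> 0" using f by (metis zero_neq_one)
qed

subsection \<open>Orders of vanishing\<close>

abbreviation "J \<equiv> gen_ideal {LY, LZ}"

lemma ideal_J: "is_ideal J"
  by (rule is_ideal_gen)

lemma LY_in_J: "LY \<in> J" and LZ_in_J: "LZ \<in> J"
  by (simp_all add: gen_ideal_mem)

text \<open>The local coordinates \<open>LY\<close>, \<open>LZ\<close> at the base point are scaled
  by an auxiliary variable s while \<open>LX\<close> is kept. The lowest power of s in the image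
  then measures the order of vanishing at \<open>u\<close>.\<close>

definition theta :: "'k poly3 \<Rightarrow> 'k poly3 poly"
  where "theta = fsub (\<lambda>c. [:cst c:]) [:LX:] [:0, LY:] [:0, LZ:]"

lemma coeff_hom_theta: "coeff_hom (\<lambda>c :: 'k. [:cst c:])"
  by unfold_locales (simp_all add: cst_hom_simps mult.commute)

lemmas theta_simps = fsub_hom[OF coeff_hom_theta, of "[:LX:]" "[:0, LY:]" "[:0, LZ:]", folded theta_def]
  fsub_coords[OF coeff_hom_theta, of "[:LX:]" "[:0, LY:]" "[:0, LZ:]", folded theta_def]

text \<open>A variable maps to a multiple of \<open>LX\<close> plus s times an element of
  \<open>J\<close>, so every factor s is paid for by a factor from \<open>J\<close>.\<close>

lemma coeff_theta_mem: "Polynomial.coeff (theta F) e \<in> ideal_power J e"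
proof (induction F arbitrary: e rule: poly3_induct)
  case (cst c)
  show ?case
  proof (cases e)
    case 0
    show ?thesis unfolding 0 ideal_power_0 by (rule UNIV_I)
  next
    case (Suc e')
    have "Polynomial.coeff (theta (cst c)) e = 0" by (simp add: theta_simps Suc)
    then show ?thesis using ideal_0_mem[OF is_ideal_power[OF ideal_J]] by metis
  qed
next
  case (add F G)
  then show ?case by (simp add: theta_simps ideal_add is_ideal_power ideal_J)
next
  case (variable j F)
  let ?l = "cst (v $ j) * LY + cst (w $ j) * LZ"
  have l: "?l \<in> J" by (intro ideal_add ideal_mult_left ideal_J LY_in_J LZ_in_J)
  have th: "theta (variable j) = [:cst (u $ j) * LX, ?l:]"
    by (simp add: theta_simps mult.commute)
  show ?case
  proof (cases e)
    case 0
    show ?thesis unfolding 0 ideal_power_0 by (rule UNIV_I)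
  next
    case (Suc e')
    have "Polynomial.coeff (theta (variable j * F)) e =
        (cst (u $ j) * LX) * Polynomial.coeff (theta F) e + Polynomial.coeff (theta F) e' * ?l"
      by (simp add: theta_simps(5) th Suc mult.commute)
    also have "\<dots> \<in> ideal_power J e"
    proof (rule ideal_add[OF is_ideal_power[OF ideal_J]])
      show "cst (u $ j) * LX * Polynomial.coeff (theta F) e \<in> ideal_power J e"
        by (rule ideal_mult_left[OF is_ideal_power[OF ideal_J] variable])
      show "Polynomial.coeff (theta F) e' * ?l \<in> ideal_power J e"
        unfolding Suc ideal_power_Suc by (intro ideal_prod_memI variable l)
    qed
    finally show ?thesis .
  qed
qed

lemma poly_theta_1: "poly (theta F) 1 = F"
proof (induction F rule: poly3_induct)
  case (variable i F)
  then show ?case using variable_eq[of i] by (simp add: theta_simps algebra_simps)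
qed (simp_all add: theta_simps)

text \<open>One direction holds because both generators of \<open>J\<close> acquire a factor s. For
  the other, setting s = 1 recovers \<open>F\<close> as the sum of its coefficients, where those
  below \<open>m\<close> vanish and the one at \<open>e\<close> lies in the \<open>e\<close>-th
  power of \<open>J\<close>.\<close>

lemma power_J_iff: "F \<in> ideal_power J m \<longleftrightarrow> [:0, 1:] ^ m dvd theta F"
proof
  assume "F \<in> ideal_power J m"
  then have "F \<in> {F. [:0, 1:] ^ m dvd theta F}"
  proof (induction rule: ideal_power_induct)
    case (ideal k)
    show ?case by (rule is_idealI) (auto simp: theta_simps)
  next
    case one
    show ?case by simp
  next
    case (step k x y)
    have "J \<subseteq> {F. [:0, 1:] dvd theta F}"
    proof (rule gen_ideal_subsetI)
      show "is_ideal {F. [:0, 1:] dvd theta F}" by (rule is_idealI) (auto simp: theta_simps)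
      have "[:0, LY:] = [:0, 1:] * [:LY:]" "[:0, LZ:] = [:0, 1:] * [:LZ:]" by simp_all
      then show "{LY, LZ} \<subseteq> {F. [:0, 1:] dvd theta F}"
        unfolding dvd_def by (auto simp: theta_simps)
    qed
    with step have "[:0, 1:] ^ k * [:0, 1:] dvd theta x * theta y" by (intro mult_dvd_mono) auto
    then show ?case by (simp only: mem_Collect_eq theta_simps(5) power_Suc2)
  qed
  then show "[:0, 1:] ^ m dvd theta F" by simp
next
  assume "[:0, 1:] ^ m dvd theta F"
  then have "Polynomial.monom 1 m dvd theta F" by (simp add: monom_altdef)
  then have z: "Polynomial.coeff (theta F) e = 0" if "e < m" for e
    using that by (simp add: monom_1_dvd_iff')
  have "poly (theta F) 1 \<in> ideal_power J m"
    unfolding poly_altdef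
  proof (rule ideal_sum[OF is_ideal_power[OF ideal_J]])
    fix e
    show "Polynomial.coeff (theta F) e * 1 ^ e \<in> ideal_power J m"
    proof (cases "e < m")
      case True
      then show ?thesis using z by (simp add: ideal_0_mem is_ideal_power ideal_J)
    next
      case False
      then show ?thesis
        using ideal_power_mono[OF ideal_J, of m e] coeff_theta_mem[of F e] by auto
    qed
  qed
  then show "F \<in> ideal_power J m" by (simp add: poly_theta_1)
qed

text \<open>The conic has order exactly one along its point: the initial form of \<open>Q\<close> is \<open>LX * LZ\<close>.\<close>

lemma conic_mult_cancel:
  assumes "Q * G \<in> ideal_power J (Suc m)"
  shows "G \<in> ideal_power J m"
proof (cases "theta G = 0")
  case True
  then show ?thesis by (simp add: power_J_iff)
next
  case False
  let ?q = "[:LX * LZ, - (LY * LY):]"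
  have q: "poly ?q 0 \<noteq> 0" using coords_nonzero by simp
  then have q0: "?q \<noteq> 0" by auto
  have "theta (Q * G) = [:0, 1:] * (?q * theta G)"
    by (simp add: Q_def theta_simps(4,5,11-13) algebra_simps)
  with assms[unfolded power_J_iff] have "[:0, 1:] * [:0, 1:] ^ m dvd [:0, 1:] * (?q * theta G)"
    by (simp only: power_Suc)
  then have "[:0, 1:] ^ m dvd ?q * theta G"
    by (subst (asm) dvd_mult_cancel_left) simp
  then have "m \<le> Polynomial.order 0 (?q * theta G)"
    using order_divides[of 0 m "?q * theta G"] False q0
    by (simp only: minus_zero mult_eq_0_iff) blast
  also have "\<dots> = Polynomial.order 0 ?q + Polynomial.order 0 (theta G)"
    by (rule order_mult) (use False q0 mult_eq_0_iff in blast)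
  also have "Polynomial.order 0 ?q = 0"
    using q order_0I by blast
  finally show ?thesis
    using order_divides[of 0 m "theta G"] by (simp add: power_J_iff)
qed

text \<open>Modulo \<open>J\<close> each variable is a multiple of \<open>LX\<close>, so a form of
  degree \<open>d\<close> is congruent to its value at \<open>u\<close> times \<open>LX ^ d\<close>.
  Conversely the two generators are linear forms vanishing at \<open>u\<close>.\<close>

lemma point_ideal_base: "point_ideal (vec.span {u}) = J"
proof
  show "point_ideal (vec.span {u}) \<subseteq> J"
    unfolding point_ideal_def
  proof (rule gen_ideal_subsetI[OF ideal_J], safe)
    fix F d assume F: "homogeneous d F" "vanishes_at F (vec.span {u})"
    then have "poly_eval F u = 0" by (simp add: vanishes_at_def vec.span_base)
    with F have "subst cst (\<lambda>i. cst (u $ i) * LX) F = 0"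
      by (simp add: subst_point_homogeneous cst_hom_simps)
    moreover have "subst cst variable F - subst cst (\<lambda>i. cst (u $ i) * LX) F \<in> J"
    proof (rule subst_cst_cong_ideal[OF ideal_J])
      fix i
      have "variable i - cst (u $ i) * LX = cst (v $ i) * LY + cst (w $ i) * LZ"
        by (subst variable_eq) simp
      also have "\<dots> \<in> J" by (intro ideal_add ideal_mult_left ideal_J LY_in_J LZ_in_J)
      finally show "variable i - cst (u $ i) * LX \<in> J" .
    qed
    ultimately show "F \<in> J" by (simp add: subst_cst_variable)
  qed
  have "vanishes_at LY (vec.span {u})" "vanishes_at LZ (vec.span {u})"
    by (auto simp: vanishes_at_def LY_def LZ_def poly_eval_lin vec.span_singleton dot_simps dual)
  moreover have "homogeneous 1 LY" "homogeneous 1 LZ"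
    unfolding LY_def LZ_def by (rule homogeneous_lin)+
  ultimately show "J \<subseteq> point_ideal (vec.span {u})"
    unfolding point_ideal_def by (intro gen_ideal_subsetI is_ideal_gen) (auto intro: gen_ideal_mem)
qed

end

text \<open>The roots are distinct, so the factors already split off do not vanish at the next root,
  and the whole order there belongs to the cofactor.\<close>

lemma prod_linear_power_dvd:
  fixes f :: "'k::field poly"
  assumes "finite A" "inj_on \<tau> A" "\<And>i. i \<in> A \<Longrightarrow> [:- \<tau> i, 1:] ^ m dvd f"
  shows "(\<Prod>i\<in>A. [:- \<tau> i, 1:]) ^ m dvd f"
proof (cases "f = 0")
  case False
  show ?thesis
    using assms
  proof (induction A)
    case (insert j A)
    let ?p = "\<Prod>i\<in>A. [:- \<tau> i, 1:]"
    from insert obtain g where g: "f = ?p ^ m * g" by (auto simp: dvd_def)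
    with False have nz: "?p ^ m * g \<noteq> 0" by simp
    have "poly (?p ^ m) (\<tau> j) \<noteq> 0"
      using insert by (auto simp: poly_prod inj_on_def)
    then have "Polynomial.order (\<tau> j) (?p ^ m) = 0"
      by (rule order_0I)
    moreover have "m \<le> Polynomial.order (\<tau> j) f"
      using insert.prems False order_divides[of "\<tau> j" m f] by simp
    ultimately have "m \<le> Polynomial.order (\<tau> j) g"
      using order_mult[OF nz] g by simp
    then have "[:- \<tau> j, 1:] ^ m dvd g"
      using order_divides by blast
    then have "[:- \<tau> j, 1:] ^ m * ?p ^ m dvd f"
      unfolding g by (subst mult.commute) (rule mult_dvd_mono[OF dvd_refl])
    then show ?case
      by (simp only: prod.insert[OF insert.hyps(1,2)] power_mult_distrib)
  qed simp
qed simp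

context conic_frame
begin

subsection \<open>The points of the conic away from infinity\<close>

definition pt :: "'k \<Rightarrow> 'k ^ 3"
  where "pt \<tau> = u + \<tau> *s v + \<tau>\<^sup>2 *s w"

text \<open>\<open>ly \<tau>\<close> is the line joining \<open>pt \<tau>\<close> to infinity and
  \<open>lz \<tau>\<close> the tangent at \<open>pt \<tau>\<close>; at \<open>pt \<sigma>\<close>
  they take the values \<sigma> - \<tau> and (\<sigma> - \<tau>)^2.\<close>

definition "ly \<tau> = LY - cst \<tau> * LX"
definition "lz \<tau> = LZ - cst (2 * \<tau>) * LY + cst (\<tau>\<^sup>2) * LX"

abbreviation "pt_ideal \<tau> \<equiv> point_ideal (vec.span {pt \<tau>})"

text \<open>Reparametrising the conic so that \<open>pt \<tau>\<close> becomes the base point leaves \<open>Q\<close> unchanged.\<close>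

lemma conic_frame_shift:
  "conic_frame (pt \<tau>) (v + (2 * \<tau>) *s w) w \<xi> (\<eta> - \<tau> *s \<xi>) (\<zeta> - (2 * \<tau>) *s \<eta> + \<tau>\<^sup>2 *s \<xi>)"
proof
  fix i j
  have *: "pt \<tau> $ i * \<xi> $ j + (v + (2 * \<tau>) *s w) $ i * (\<eta> - \<tau> *s \<xi>) $ j
      + w $ i * (\<zeta> - (2 * \<tau>) *s \<eta> + \<tau>\<^sup>2 *s \<xi>) $ j = u $ i * \<xi> $ j + v $ i * \<eta> $ j + w $ i * \<zeta> $ j"
    unfolding pt_def vector_add_component vector_minus_component vector_smult_component
    by (simp add: algebra_simps power2_eq_square)
  show "pt \<tau> $ i * \<xi> $ j + (v + (2 * \<tau>) *s w) $ i * (\<eta> - \<tau> *s \<xi>) $ j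
      + w $ i * (\<zeta> - (2 * \<tau>) *s \<eta> + \<tau>\<^sup>2 *s \<xi>) $ j = (if i = j then 1 else 0)"
    unfolding * by (rule resolution)
qed (simp_all add: pt_def dot_simps dual power2_eq_square)

lemma conic_shift: "LX * lz \<tau> - ly \<tau> * ly \<tau> = Q"
  by (simp add: Q_def ly_def lz_def cst_hom_simps power2_eq_square algebra_simps)

text \<open>Both facts are those about the base point, read in the shifted frame, whose coordinate
  forms are \<open>LX\<close>, \<open>ly \<tau>\<close>, \<open>lz \<tau>\<close> and whose conic is
  again \<open>Q\<close>.\<close>

lemma point_ideal_pt: "pt_ideal \<tau> = gen_ideal {ly \<tau>, lz \<tau>}"
  and conic_mult_cancel_pt: "Q * G \<in> ideal_power (pt_ideal \<tau>) (Suc m) \<Longrightarrow> G \<in> ideal_power (pt_ideal \<tau>) m"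
proof -
  interpret P: conic_frame "pt \<tau>" "v + (2 * \<tau>) *s w" w \<xi> "\<eta> - \<tau> *s \<xi>" "\<zeta> - (2 * \<tau>) *s \<eta> + \<tau>\<^sup>2 *s \<xi>"
    by (rule conic_frame_shift)
  have PY: "P.LY = ly \<tau>" by (simp add: ly_def LX_def LY_def P.LY_def lin_simps)
  have PZ: "P.LZ = lz \<tau>" by (simp add: lz_def LX_def LY_def LZ_def P.LZ_def lin_simps)
  have "P.Q = LX * lz \<tau> - ly \<tau> * ly \<tau>"
    by (simp only: P.Q_def PY PZ)
  then have PQ: "P.Q = Q" by (simp only: conic_shift)
  show "pt_ideal \<tau> = gen_ideal {ly \<tau>, lz \<tau>}"
    using P.point_ideal_base by (simp add: PY PZ)
  show "G \<in> ideal_power (pt_ideal \<tau>) m" if "Q * G \<in> ideal_power (pt_ideal \<tau>) (Suc m)"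
    using P.conic_mult_cancel[of G m] that by (simp only: P.point_ideal_base PQ)
qed

lemma ly_mem: "ly \<tau> \<in> pt_ideal \<tau>" and lz_mem: "lz \<tau> \<in> pt_ideal \<tau>"
  by (simp_all add: point_ideal_pt gen_ideal_mem)

lemma conic_mem_pt: "Q \<in> pt_ideal \<tau>"
  unfolding conic_shift[of \<tau>, symmetric]
  by (intro ideal_diff ideal_mult_left ideal_point_ideal ly_mem lz_mem)

text \<open>The line through \<open>pt \<sigma>\<close> and \<open>pt \<tau>\<close>: restricted to
  the conic it has the roots \<sigma> and \<tau>. Equal arguments give the tangent.\<close>

definition chord :: "'k \<Rightarrow> 'k \<Rightarrow> 'k poly3"
  where "chord \<sigma> \<tau> = LZ - cst (\<sigma> + \<tau>) * LY + cst (\<sigma> * \<tau>) * LX"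

lemma chord_commute: "chord \<sigma> \<tau> = chord \<tau> \<sigma>"
  by (simp add: chord_def add.commute mult.commute)

lemma chord_mem: "chord \<sigma> \<tau> \<in> pt_ideal \<sigma>" "chord \<sigma> \<tau> \<in> pt_ideal \<tau>"
proof -
  have *: "chord \<sigma> \<tau> \<in> pt_ideal \<sigma>" for \<sigma> \<tau>
  proof -
    have "chord \<sigma> \<tau> = lz \<sigma> + cst (\<sigma> - \<tau>) * ly \<sigma>"
      by (simp add: chord_def ly_def lz_def cst_hom_simps power2_eq_square algebra_simps)
    then show ?thesis
      by (simp only:) (intro ideal_add ideal_mult_left ideal_point_ideal ly_mem lz_mem)
  qed
  show "chord \<sigma> \<tau> \<in> pt_ideal \<sigma>" by (rule *)
  show "chord \<sigma> \<tau> \<in> pt_ideal \<tau>" using *[of \<tau> \<sigma>] by (simp add: chord_commute)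
qed

subsection \<open>Restriction to the conic\<close>

text \<open>With s the outer and t the inner variable, \<open>LX\<close>, \<open>LY\<close>,
  \<open>LZ\<close> become s, s t, s t^2. The exponent of s records the degree, so no homogeneity
  has to be assumed.\<close>

definition rho :: "'k poly3 \<Rightarrow> 'k poly poly"
  where "rho = fsub (\<lambda>c. [:[:c:]:]) [:0, 1:] [:0, [:0, 1:]:] [:0, [:0, 0, 1:]:]"

lemma coeff_hom_rho: "coeff_hom (\<lambda>c :: 'k. [:[:c:]:])"
  by unfold_locales (simp_all add: one_pCons)

lemmas rho_simps = fsub_hom[OF coeff_hom_rho, of "[:0, 1:]" "[:0, [:0, 1:]:]" "[:0, [:0, 0, 1:]:]", folded rho_def]
  fsub_coords[OF coeff_hom_rho, of "[:0, 1:]" "[:0, [:0, 1:]:]" "[:0, [:0, 0, 1:]:]", folded rho_def]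

lemma rho_Q: "rho Q = 0"
  by (simp add: Q_def rho_simps)

lemma rho_ly: "rho (ly \<tau>) = [:0, [:- \<tau>, 1:]:]"
  by (simp add: ly_def rho_simps)

lemma rho_lz: "rho (lz \<tau>) = [:0, [:- \<tau>, 1:] * [:- \<tau>, 1:]:]"
  by (simp add: lz_def rho_simps power2_eq_square)

lemma rho_chord: "rho (chord \<sigma> \<tau>) = [:0, [:- \<sigma>, 1:] * [:- \<tau>, 1:]:]"
  by (simp add: chord_def rho_simps)

text \<open>The generators of the point ideal restrict to s (t - \<tau>) and s (t - \<tau>)^2, and
  divisibility multiplies along the powers.\<close>

lemma rho_pt_ideal_power:
  assumes "F \<in> ideal_power (pt_ideal \<tau>) m"
  shows "[:[:- \<tau>, 1:] ^ m:] dvd rho F"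
proof -
  have "F \<in> {F. [:[:- \<tau>, 1:] ^ m:] dvd rho F}"
    using assms
  proof (induction rule: ideal_power_induct)
    case (ideal k)
    show ?case by (rule is_idealI) (auto simp: rho_simps)
  next
    case one
    show ?case by (simp flip: one_pCons)
  next
    case (step k x y)
    have "pt_ideal \<tau> \<subseteq> {F. [:[:- \<tau>, 1:]:] dvd rho F}"
      unfolding point_ideal_pt
    proof (rule gen_ideal_subsetI)
      show "is_ideal {F. [:[:- \<tau>, 1:]:] dvd rho F}" by (rule is_idealI) (auto simp: rho_simps)
      show "{ly \<tau>, lz \<tau>} \<subseteq> {F. [:[:- \<tau>, 1:]:] dvd rho F}"
        by (auto simp: rho_ly rho_lz const_poly_dvd_iff coeff_pCons split: nat.splits simp del: mult_pCons_left mult_pCons_right)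
    qed
    with step have "[:[:- \<tau>, 1:] ^ k:] * [:[:- \<tau>, 1:]:] dvd rho x * rho y" by (intro mult_dvd_mono) auto
    moreover have "[:[:- \<tau>, 1:] ^ k:] * [:[:- \<tau>, 1:]:] = [:[:- \<tau>, 1:] ^ Suc k:]"
      by (simp only: power_Suc2) simp
    ultimately show ?case by (simp only: mem_Collect_eq rho_simps(5))
  qed
  then show ?thesis by simp
qed

lemma degree_coeff_rho: "Polynomial.degree (Polynomial.coeff (rho F) d) \<le> 2 * d"
proof (induction F arbitrary: d rule: poly3_induct)
  case (cst c)
  show ?case by (cases d) (simp_all add: rho_simps)
next
  case (add F G)
  then show ?case by (simp add: rho_simps degree_add_le)
next
  case (variable j F)
  let ?p = "[:u $ j, v $ j, w $ j:]"
  have r: "rho (variable j * F) = [:0, ?p:] * rho F"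
    by (simp add: rho_simps)
  show ?case
  proof (cases d)
    case 0
    then show ?thesis by (simp add: r)
  next
    case (Suc d')
    have "Polynomial.coeff (rho (variable j * F)) d = ?p * Polynomial.coeff (rho F) d'"
      by (simp add: r Suc)
    also have "Polynomial.degree \<dots> \<le> Polynomial.degree ?p + Polynomial.degree (Polynomial.coeff (rho F) d')"
      by (rule degree_mult_le)
    also have "\<dots> \<le> 2 + 2 * d'"
      by (intro add_mono variable) simp
    finally show ?thesis by (simp add: Suc)
  qed
qed

section \<open>Normal forms modulo the conic, kernel and image of the restriction\<close>

text \<open>For \<open>k \<le> 2 * d\<close> this is the monomial of degree \<open>d\<close> in the
  frame coordinates that restricts to s^d t^k and has at most one factor \<open>LY\<close>.\<close>

definition nmon :: "nat \<times> nat \<Rightarrow> 'k poly3"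
  where "nmon = (\<lambda>(d, k). LX ^ (d - (k + 1) div 2) * LY ^ (k mod 2) * LZ ^ (k div 2))"

lemma rho_nmon:
  assumes "k \<le> 2 * d"
  shows "rho (nmon (d, k)) = Polynomial.monom (Polynomial.monom 1 k) d"
proof -
  have r: "rho LX = Polynomial.monom 1 1" "rho LY = Polynomial.monom (Polynomial.monom 1 1) 1"
    "rho LZ = Polynomial.monom (Polynomial.monom 1 2) 1"
    by (simp_all add: rho_simps monom_Suc monom_0 numeral_2_eq_2)
  show ?thesis
  proof (cases "even k")
    case True
    then obtain l where "k = 2 * l" by blast
    with assms show ?thesis
      by (simp add: nmon_def rho_simps(5,6) r Polynomial.monom_power mult_monom)
  next
    case False
    then obtain l where "k = 2 * l + 1" by (elim oddE)
    with assms show ?thesis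
      by (simp add: nmon_def rho_simps(5,6) r Polynomial.monom_power mult_monom)
  qed
qed

definition nf :: "'k poly3 \<Rightarrow> bool"
  where "nf F \<longleftrightarrow> (\<exists>A c. finite A \<and> A \<subseteq> {(d, k). k \<le> 2 * d} \<and> Q dvd F - (\<Sum>x\<in>A. cst (c x) * nmon x))"

lemma nf_add:
  assumes "nf F" "nf G"
  shows "nf (F + G)"
proof -
  from assms(1) obtain A c where A: "finite A" "A \<subseteq> {(d, k). k \<le> 2 * d}" "Q dvd F - (\<Sum>x\<in>A. cst (c x) * nmon x)"
    unfolding nf_def by (elim exE conjE)
  from assms(2) obtain B e where B: "finite B" "B \<subseteq> {(d, k). k \<le> 2 * d}" "Q dvd G - (\<Sum>x\<in>B. cst (e x) * nmon x)"
    unfolding nf_def by (elim exE conjE)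
  define f where "f x = (if x \<in> A then c x else 0) + (if x \<in> B then e x else 0)" for x
  have 1: "(\<Sum>x\<in>A \<union> B. cst (if x \<in> A then c x else 0) * nmon x) = (\<Sum>x\<in>A. cst (c x) * nmon x)"
    by (rule sum.mono_neutral_cong_right) (use A B in \<open>auto simp: cst_hom_simps\<close>)
  have 2: "(\<Sum>x\<in>A \<union> B. cst (if x \<in> B then e x else 0) * nmon x) = (\<Sum>x\<in>B. cst (e x) * nmon x)"
    by (rule sum.mono_neutral_cong_right) (use A B in \<open>auto simp: cst_hom_simps\<close>)
  have "(\<Sum>x\<in>A \<union> B. cst (f x) * nmon x) = (\<Sum>x\<in>A. cst (c x) * nmon x) + (\<Sum>x\<in>B. cst (e x) * nmon x)"
    unfolding f_def cst_hom_simps(3) distrib_right sum.distrib 1 2 ..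
  then have "F + G - (\<Sum>x\<in>A \<union> B. cst (f x) * nmon x) =
      (F - (\<Sum>x\<in>A. cst (c x) * nmon x)) + (G - (\<Sum>x\<in>B. cst (e x) * nmon x))"
    by simp
  then have "Q dvd F + G - (\<Sum>x\<in>A \<union> B. cst (f x) * nmon x)"
    using A(3) B(3) by (simp only: dvd_add)
  then show ?thesis
    unfolding nf_def using A(1,2) B(1,2) by (intro exI[of _ "A \<union> B"] exI[of _ f]) auto
qed

lemma nf_nmon: "k \<le> 2 * d \<Longrightarrow> nf (cst c * nmon (d, k))"
  unfolding nf_def by (intro exI[of _ "{(d, k)}"] exI[of _ "\<lambda>_. c"]) auto

lemma nf_0: "nf 0"
  unfolding nf_def by (intro exI[of _ "{}"]) auto

lemma nf_sum: "(\<And>x. x \<in> A \<Longrightarrow> nf (f x)) \<Longrightarrow> nf (sum f A)"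
  by (induction A rule: infinite_finite_induct) (simp_all add: nf_0 nf_add)

lemma nf_cong:
  assumes "Q dvd F - G" "nf G"
  shows "nf F"
proof -
  from assms(2) obtain A c where A: "finite A" "A \<subseteq> {(d, k). k \<le> 2 * d}"
      "Q dvd G - (\<Sum>x\<in>A. cst (c x) * nmon x)"
    unfolding nf_def by blast
  have "Q dvd (F - G) + (G - (\<Sum>x\<in>A. cst (c x) * nmon x))"
    by (rule dvd_add[OF assms(1) A(3)])
  then have "Q dvd F - (\<Sum>x\<in>A. cst (c x) * nmon x)"
    by (simp only: diff_add_cancel add_diff_eq)
  with A(1,2) show ?thesis unfolding nf_def by blast
qed

lemma nf_mult:
  assumes F: "nf F" and L: "\<And>d k c. k \<le> 2 * d \<Longrightarrow> nf (L * (cst c * nmon (d, k)))"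
  shows "nf (L * F)"
proof -
  from F obtain A c where A: "A \<subseteq> {(d, k). k \<le> 2 * d}" "Q dvd F - (\<Sum>x\<in>A. cst (c x) * nmon x)"
    unfolding nf_def by blast
  have "Q dvd L * F - (\<Sum>x\<in>A. L * (cst (c x) * nmon x))"
    using dvd_mult[OF A(2), of L] by (simp only: right_diff_distrib sum_distrib_left)
  moreover have "nf (\<Sum>x\<in>A. L * (cst (c x) * nmon x))"
    by (rule nf_sum) (use A(1) L in auto)
  ultimately show ?thesis by (rule nf_cong)
qed

lemma nf_mult_LX: "nf F \<Longrightarrow> nf (LX * F)"
proof (erule nf_mult)
  fix d k c assume k: "k \<le> 2 * (d :: nat)"
  \<comment> \<open>The bound on \<open>k\<close> keeps the truncated exponent of \<open>LX\<close>
    exact, so it grows with \<open>d\<close>.\<close>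
  then have "Suc d - (k + 1) div 2 = Suc (d - (k + 1) div 2)" by linarith
  then have "LX * (cst c * nmon (d, k)) = cst c * nmon (Suc d, k)"
    by (simp add: nmon_def mult_ac)
  then show "nf (LX * (cst c * nmon (d, k)))" using k by (simp only: nf_nmon le_SucI mult_Suc_right trans_le_add2)
qed

lemma nf_mult_LZ: "nf F \<Longrightarrow> nf (LZ * F)"
proof (erule nf_mult)
  fix d k c assume k: "k \<le> 2 * (d :: nat)"
  have "LZ * (cst c * nmon (d, k)) = cst c * nmon (Suc d, Suc (Suc k))"
    by (simp add: nmon_def mult_ac)
  moreover have "Suc (Suc k) \<le> 2 * Suc d" using k by simp
  ultimately show "nf (LZ * (cst c * nmon (d, k)))" by (simp only: nf_nmon)
qed

text \<open>Only here is the relation used: for odd \<open>k\<close> the new factor produces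
  \<open>LY * LY\<close>, which is replaced by \<open>LX * LZ\<close> at the cost of a multiple of
  \<open>Q\<close>.\<close>

lemma nf_mult_LY: "nf F \<Longrightarrow> nf (LY * F)"
proof (erule nf_mult)
  fix d k c assume k: "k \<le> 2 * (d :: nat)"
  have "Q dvd LY * (cst c * nmon (d, k)) - cst c * nmon (Suc d, Suc k)"
  proof (cases "even k")
    case True
    then obtain l where "k = 2 * l" by blast
    then have "LY * (cst c * nmon (d, k)) = cst c * nmon (Suc d, Suc k)"
      by (simp add: nmon_def)
    then show ?thesis by (simp only: diff_self dvd_0_right)
  next
    case False
    then obtain l where l: "k = 2 * l + 1" by (elim oddE)
    with k obtain d' where d: "d = l + 1 + d'" by (metis Suc_eq_plus1 Suc_leI le_Suc_ex less_eq_Suc_le nat_mult_less_cancel_disj)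
    have "LY * (cst c * nmon (d, k)) - cst c * nmon (Suc d, Suc k) = Q * (- (cst c * LX ^ d' * LZ ^ l))"
    proof -
      have "nmon (d, k) = LX ^ d' * LY * LZ ^ l" "nmon (Suc d, Suc k) = LX ^ Suc d' * LZ ^ Suc l"
        by (simp_all add: nmon_def l d)
      then show ?thesis by (simp only: Q_def) (simp add: algebra_simps)
    qed
    then show ?thesis by simp
  qed
  moreover have "nf (cst c * nmon (Suc d, Suc k))" using k by (simp add: nf_nmon)
  ultimately show "nf (LY * (cst c * nmon (d, k)))" by (rule nf_cong)
qed

lemma nf_cst_mult: "nf F \<Longrightarrow> nf (cst a * F)"
proof (erule nf_mult)
  fix d k c assume k: "k \<le> 2 * (d :: nat)"
  then show "nf (cst a * (cst c * nmon (d, k)))"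
    using nf_nmon[OF k, of "a * c"] by (simp only: cst_hom_simps mult.assoc)
qed

lemma nf_all: "nf F"
proof (induction F rule: poly3_induct)
  case (cst c)
  show ?case using nf_nmon[of 0 0 c] by (simp add: nmon_def)
next
  case (variable j F)
  then have "nf (cst (u $ j) * (LX * F) + cst (v $ j) * (LY * F) + cst (w $ j) * (LZ * F))"
    by (intro nf_add nf_cst_mult nf_mult_LX nf_mult_LY nf_mult_LZ)
  then show ?case
    by (simp only: variable_eq[of j] distrib_right mult.assoc)
qed (rule nf_add)

text \<open>Normal monomials restrict to distinct monomials s^d t^k, which are linearly independent,
  so the normal form of \<open>F\<close> has only zero coefficients.\<close>

lemma rho_kernel:
  assumes "rho F = 0"
  shows "Q dvd F"
proof -
  from nf_all[of F] obtain A c where A: "finite A" "A \<subseteq> {(d, k). k \<le> 2 * d}"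
      "Q dvd F - (\<Sum>x\<in>A. cst (c x) * nmon x)"
    unfolding nf_def by blast
  then obtain H where H: "F - (\<Sum>x\<in>A. cst (c x) * nmon x) = Q * H" by (auto simp: dvd_def)
  have "rho (F - (\<Sum>x\<in>A. cst (c x) * nmon x)) = 0"
    unfolding H by (simp add: rho_simps rho_Q)
  with assms have "(\<Sum>x\<in>A. rho (cst (c x) * nmon x)) = 0"
    by (simp add: rho_simps)
  moreover have "(\<Sum>x\<in>A. rho (cst (c x) * nmon x)) = (\<Sum>x\<in>A. Polynomial.monom (Polynomial.monom (c x) (snd x)) (fst x))"
    by (rule sum.cong) (use A(2) in \<open>auto simp: rho_simps rho_nmon smult_monom\<close>)
  ultimately have z: "(\<Sum>x\<in>A. Polynomial.monom (Polynomial.monom (c x) (snd x)) (fst x)) = 0" by simp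
  have "c y = 0" if "y \<in> A" for y
  proof -
    have "0 = Polynomial.coeff (Polynomial.coeff (\<Sum>x\<in>A. Polynomial.monom (Polynomial.monom (c x) (snd x)) (fst x)) (fst y)) (snd y)"
      unfolding z by simp
    also have "\<dots> = (\<Sum>x\<in>A. if x = y then c y else 0)"
      unfolding Polynomial.coeff_sum by (rule sum.cong) (auto simp: prod_eq_iff)
    finally show ?thesis using A(1) that by simp
  qed
  then have "(\<Sum>x\<in>A. cst (c x) * nmon x) = 0"
    by (simp add: cst_hom_simps)
  with A(3) show ?thesis by simp
qed

text \<open>The degree bound says that only monomials s^d t^k with \<open>k \<le> 2 * d\<close>
  occur, and each is the restriction of \<open>nmon (d, k)\<close>.\<close>

lemma rho_surj:
  assumes "\<And>d. Polynomial.degree (Polynomial.coeff f d) \<le> 2 * d"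
  shows "\<exists>G. rho G = f"
proof -
  define G where "G = (\<Sum>d\<le>Polynomial.degree f. \<Sum>k\<le>2 * d. cst (Polynomial.coeff (Polynomial.coeff f d) k) * nmon (d, k))"
  have "rho G = (\<Sum>d\<le>Polynomial.degree f. \<Sum>k\<le>2 * d. Polynomial.monom (Polynomial.monom (Polynomial.coeff (Polynomial.coeff f d) k) k) d)"
    unfolding G_def rho_simps by (intro sum.cong refl) (simp add: rho_nmon smult_monom)
  also have "\<dots> = (\<Sum>d\<le>Polynomial.degree f. Polynomial.monom (\<Sum>k\<le>2 * d. Polynomial.monom (Polynomial.coeff (Polynomial.coeff f d) k) k) d)"
    by (simp add: Polynomial.monom_sum)
  also have "\<dots> = (\<Sum>d\<le>Polynomial.degree f. Polynomial.monom (Polynomial.coeff f d) d)"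
    by (simp add: poly_as_sum_of_monoms' assms)
  also have "\<dots> = f" by (rule poly_as_sum_of_monoms)
  finally show ?thesis by blast
qed

end

section \<open>Curves through the points and their restrictions\<close>

lemma prod_monom: "(\<Prod>i\<in>A. Polynomial.monom (c i) 1) = Polynomial.monom (\<Prod>i\<in>A. c i) (card A)"
  for c :: "'b \<Rightarrow> 'a::comm_semiring_1"
  by (induction A rule: infinite_finite_induct) (simp_all add: mult_monom one_pCons monom_0)

lemma prod_pairs: "(\<Prod>i<l. f (2 * i) * f (2 * i + 1)) = (\<Prod>i<2 * l. f i)" for f :: "nat \<Rightarrow> 'a::comm_monoid_mult"
  by (induction l) (simp_all add: mult.assoc)

lemma irrelevant_ideal_lin: "lin a \<in> irrelevant_ideal"
proof -
  have "variable i \<in> irrelevant_ideal" for i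
    unfolding irrelevant_ideal_def by (rule gen_ideal_mem) simp
  then show ?thesis
    unfolding lin_def by (intro ideal_sum ideal_mult_left ideal_irrelevant_ideal)
qed

locale conic_points = conic_frame u v w \<xi> \<eta> \<zeta>
  for u v w \<xi> \<eta> \<zeta> :: "'k::field ^ 3" +
  fixes l :: nat and \<tau> :: "nat \<Rightarrow> 'k"
  assumes l: "l \<ge> 1" and inj: "inj_on \<tau> {..2 * l}"
begin

definition pts :: "('k ^ 3) set set"
  where "pts = (\<lambda>i. vec.span {pt (\<tau> i)}) ` {..2 * l}"

abbreviation "symb \<equiv> symbolic_power pts"

lemma symb_iff: "F \<in> symb m \<longleftrightarrow> (\<forall>i\<le>2 * l. F \<in> ideal_power (pt_ideal (\<tau> i)) m)"
  by (auto simp: symbolic_power_def pts_def)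

lemma symb_0: "symb 0 = UNIV"
  by (simp only: set_eq_iff symb_iff ideal_power_0) simp

lemma symb_1_iff: "F \<in> symb 1 \<longleftrightarrow> (\<forall>i\<le>2 * l. F \<in> pt_ideal (\<tau> i))"
  by (simp only: symb_iff ideal_power_1[OF ideal_point_ideal])

lemma conic_symb: "Q \<in> symb 1"
  by (simp only: symb_1_iff conic_mem_pt) simp

lemma conic_mult_cancel_symb: "Q * G \<in> symb (Suc m) \<Longrightarrow> G \<in> symb m"
  unfolding symb_iff using conic_mult_cancel_pt by blast

definition "p = (\<Prod>i<Suc (2 * l). [:- \<tau> i, 1:])"

text \<open>\<open>polygon\<close> is the open path from the first to the last point, and
  \<open>P\<close> adds the closing side. \<open>matching\<close> pairs off all points except the
  last.\<close>

definition "polygon = (\<Prod>i<2 * l. chord (\<tau> i) (\<tau> (Suc i)))"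
definition "P = polygon * chord (\<tau> (2 * l)) (\<tau> 0)"
definition "matching = (\<Prod>i<l. chord (\<tau> (2 * i)) (\<tau> (2 * i + 1)))"
definition "A = matching * ly (\<tau> (2 * l))"
definition "B = matching * chord (\<tau> (2 * l)) 0"

lemma prod_mem_ideal:
  assumes "is_ideal I" "finite K" "i \<in> K" "f i \<in> I"
  shows "prod f K \<in> I"
  unfolding prod.remove[OF assms(2,3)] by (rule ideal_mult_right) (use assms in auto)

lemma polygon_symb: "polygon \<in> symb 1"
  unfolding symb_1_iff polygon_def
proof safe
  fix i assume i: "i \<le> 2 * l"
  show "(\<Prod>i<2 * l. chord (\<tau> i) (\<tau> (Suc i))) \<in> pt_ideal (\<tau> i)"
  proof (cases "i = 0")
    case True
    with l show ?thesis
      by (intro prod_mem_ideal[of _ _ 0] ideal_point_ideal) (simp_all add: chord_mem)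
  next
    case False
    with i show ?thesis
      by (intro prod_mem_ideal[of _ _ "i - 1"] ideal_point_ideal) (simp_all add: chord_mem)
  qed
qed

text \<open>Every vertex of the closed polygon lies on two of its sides, and each side contributes
  one order of vanishing.\<close>

lemma P_symb: "P \<in> symb 2"
  unfolding symb_iff
proof safe
  fix i assume i: "i \<le> 2 * l"
  let ?J = "ideal_power (pt_ideal (\<tau> i))"
  have two: "x * y \<in> ?J 2" if "x \<in> pt_ideal (\<tau> i)" "y \<in> pt_ideal (\<tau> i)" for x y
    using ideal_power_mult_mem[OF ideal_point_ideal that[THEN ideal_power_1_mem[OF ideal_point_ideal]]]
    by (simp only: one_add_one)
  show "P \<in> ?J 2"
  \<comment> \<open>At the two ends of the path, one of the two sides is the closing one; at all
    other vertices both belong to the path.\<close>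
  proof (cases "i = 0 \<or> i = 2 * l")
    case True
    then show ?thesis
      unfolding P_def using polygon_symb i by (intro two) (auto simp only: symb_1_iff chord_mem)
  next
    case False
    let ?f = "\<lambda>i. chord (\<tau> i) (\<tau> (Suc i))"
    have "polygon = prod ?f ({..<2 * l} - {i - 1, i}) * prod ?f {i - 1, i}"
      unfolding polygon_def by (rule prod.subset_diff) (use False i in auto)
    also have "prod ?f {i - 1, i} = ?f (i - 1) * ?f i"
    proof -
      have "i - Suc 0 \<noteq> i" using False by linarith
      then show ?thesis by simp
    qed
    also have "prod ?f ({..<2 * l} - {i - 1, i}) * (?f (i - 1) * ?f i) \<in> ?J 2"
      by (intro ideal_mult_left is_ideal_power ideal_point_ideal two) (use False in \<open>simp_all add: chord_mem\<close>)
    finally show ?thesis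
      unfolding P_def by (rule ideal_mult_right[OF is_ideal_power[OF ideal_point_ideal]])
  qed
qed

lemma matching_mult_symb: "L \<in> pt_ideal (\<tau> (2 * l)) \<Longrightarrow> matching * L \<in> symb 1"
  unfolding symb_1_iff
proof safe
  fix i assume L: "L \<in> pt_ideal (\<tau> (2 * l))" and i: "i \<le> 2 * l"
  show "matching * L \<in> pt_ideal (\<tau> i)"
  proof (cases "i = 2 * l")
    case True
    with L show ?thesis by (simp add: ideal_mult_left ideal_point_ideal)
  next
    case False
    have "matching \<in> pt_ideal (\<tau> i)"
      unfolding matching_def
    proof (rule prod_mem_ideal[OF ideal_point_ideal])
      show "i div 2 \<in> {..<l}" using i False by auto
      have "i = 2 * (i div 2) \<or> i = 2 * (i div 2) + 1" by presburger
      then show "chord (\<tau> (2 * (i div 2))) (\<tau> (2 * (i div 2) + 1)) \<in> pt_ideal (\<tau> i)"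
        using chord_mem by metis
    qed simp
    then show ?thesis by (rule ideal_mult_right[OF ideal_point_ideal])
  qed
qed

lemma A_symb: "A \<in> symb 1" and B_symb: "B \<in> symb 1"
  unfolding A_def B_def by (intro matching_mult_symb ly_mem chord_mem)+

lemma rho_chord_monom: "rho (chord \<sigma> \<rho>) = Polynomial.monom ([:- \<sigma>, 1:] * [:- \<rho>, 1:]) 1"
  by (simp only: rho_chord monom_Suc monom_0 One_nat_def)

lemma rho_polygon: "rho polygon = Polynomial.monom ((\<Prod>i<2 * l. [:- \<tau> i, 1:]) * (\<Prod>i<2 * l. [:- \<tau> (Suc i), 1:])) (2 * l)"
  unfolding polygon_def rho_simps(7) rho_chord_monom prod_monom by (simp only: prod.distrib card_lessThan)

text \<open>Going round the polygon, each point is once the start and once the end of a side, so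
  starts and ends each contribute one factor \<open>p\<close>.\<close>

lemma rho_P: "rho P = Polynomial.monom (p ^ 2) (2 * l + 1)"
proof -
  have "(\<Prod>i<2 * l. [:- \<tau> (Suc i), 1:]) * [:- \<tau> 0, 1:] = p"
    unfolding p_def prod.lessThan_Suc_shift by (rule mult.commute)
  moreover have "(\<Prod>i<2 * l. [:- \<tau> i, 1:]) * [:- \<tau> (2 * l), 1:] = p"
    unfolding p_def prod.lessThan_Suc ..
  moreover have "rho P = Polynomial.monom (((\<Prod>i<2 * l. [:- \<tau> i, 1:]) * [:- \<tau> (2 * l), 1:]) *
      ((\<Prod>i<2 * l. [:- \<tau> (Suc i), 1:]) * [:- \<tau> 0, 1:])) (2 * l + 1)"
    unfolding P_def rho_simps(5) rho_polygon rho_chord_monom mult_monom by (simp only: mult_ac)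
  ultimately show ?thesis by (simp only: power2_eq_square)
qed

lemma rho_matching: "rho matching = Polynomial.monom (\<Prod>i<2 * l. [:- \<tau> i, 1:]) l"
  unfolding matching_def rho_simps(7) rho_chord_monom prod_monom card_lessThan
  by (simp only: prod_pairs[of "\<lambda>i. [:- \<tau> i, 1:]"])

lemma rho_A: "rho A = Polynomial.monom p (l + 1)"
proof -
  have "rho (ly (\<tau> (2 * l))) = Polynomial.monom [:- \<tau> (2 * l), 1:] 1"
    by (simp only: rho_ly monom_Suc monom_0 One_nat_def)
  then show ?thesis
    unfolding A_def rho_simps(5) rho_matching by (simp only: mult_monom p_def prod.lessThan_Suc)
qed

lemma rho_B: "rho B = Polynomial.monom ([:0, 1:] * p) (l + 1)"
  unfolding B_def rho_simps(5) rho_matching rho_chord_monom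
  by (simp only: mult_monom p_def prod.lessThan_Suc minus_zero mult_ac)

section \<open>Degree bounds and decomposition modulo the conic\<close>

lemma p_nonzero: "p \<noteq> 0"
  unfolding p_def by (subst prod_zero_iff) auto

lemma degree_p: "Polynomial.degree p = 2 * l + 1"
  unfolding p_def by (subst degree_prod_sum_eq) auto

text \<open>Bezout: a curve meeting the conic with multiplicity \<open>N\<close> at the points has degree at least
  \<open>N * (2 * l + 1) / 2\<close>, or contains the conic.\<close>

lemma rho_symb:
  assumes "F \<in> symb N"
  obtains g where "rho F = [:p ^ N:] * g"
    and "\<And>d. Polynomial.coeff g d \<noteq> 0 \<Longrightarrow> (2 * l + 1) * N + Polynomial.degree (Polynomial.coeff g d) \<le> 2 * d"
proof -
  have "p ^ N dvd Polynomial.coeff (rho F) d" for d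
    unfolding p_def
  proof (rule prod_linear_power_dvd)
    show "inj_on \<tau> {..<Suc (2 * l)}" using inj by (simp add: lessThan_Suc_atMost)
    fix i assume "i \<in> {..<Suc (2 * l)}"
    then have "[:[:- \<tau> i, 1:] ^ N:] dvd rho F"
      using assms by (intro rho_pt_ideal_power) (simp add: symb_iff)
    then show "[:- \<tau> i, 1:] ^ N dvd Polynomial.coeff (rho F) d"
      by (simp only: const_poly_dvd_iff)
  qed simp
  then have "[:p ^ N:] dvd rho F" by (simp only: const_poly_dvd_iff) simp
  then obtain g where g: "rho F = [:p ^ N:] * g" by (elim dvdE)
  show thesis
  proof (rule that[OF g])
    fix d assume nz: "Polynomial.coeff g d \<noteq> 0"
    have "Polynomial.degree (p ^ N * Polynomial.coeff g d) \<le> 2 * d"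
      using degree_coeff_rho[of F d] by (simp add: g)
    then show "(2 * l + 1) * N + Polynomial.degree (Polynomial.coeff g d) \<le> 2 * d"
      using nz p_nonzero by (simp add: degree_mult_eq degree_power_eq degree_p mult.commute)
  qed
qed

text \<open>The bound forces the coefficients below \<open>D\<close> to vanish. Dividing by s^D
  leaves exactly the degree bound that characterises restrictions.\<close>

lemma rho_lift:
  assumes "\<And>d. Polynomial.coeff f d \<noteq> 0 \<Longrightarrow> 2 * D + Polynomial.degree (Polynomial.coeff f d) \<le> 2 * d"
  obtains G where "f = Polynomial.monom 1 D * rho G"
proof -
  have "Polynomial.coeff f d = 0" if "d < D" for d
    using assms[of d] that by (cases "Polynomial.coeff f d = 0") auto
  then have "Polynomial.monom 1 D dvd f" by (simp add: monom_1_dvd_iff')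
  then obtain g where g: "f = Polynomial.monom 1 D * g" by (elim dvdE)
  have "Polynomial.degree (Polynomial.coeff g d) \<le> 2 * d" for d
    using assms[of "d + D"] by (cases "Polynomial.coeff g d = 0") (simp_all add: g coeff_monom_mult)
  then obtain G where "rho G = g" using rho_surj by blast
  with g show thesis by (intro that[of G]) simp
qed

lemma dvd_conic_if_rho_eq: "rho F = rho G \<Longrightarrow> \<exists>H. F = G + Q * H"
  using rho_kernel[of "F - G"] by (auto simp: rho_simps(4) dvd_def algebra_simps)

text \<open>After division by \<open>p ^ (2 * M)\<close> the degree bound is that of a restriction
  shifted by \<open>(2 * l + 1) * M\<close>, the degree of \<open>P ^ M\<close>. Hence
  \<open>F\<close> and a multiple of \<open>P ^ M\<close> have the same restriction.\<close>

lemma symb_decomp_even: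
  assumes "F \<in> symb (2 * M)"
  shows "\<exists>G H. F = P ^ M * G + Q * H"
proof -
  from assms obtain g where g: "rho F = [:p ^ (2 * M):] * g"
    and deg: "\<And>d. Polynomial.coeff g d \<noteq> 0 \<Longrightarrow> (2 * l + 1) * (2 * M) + Polynomial.degree (Polynomial.coeff g d) \<le> 2 * d"
    by (elim rho_symb) blast
  obtain G where G: "g = Polynomial.monom 1 ((2 * l + 1) * M) * rho G"
    by (rule rho_lift[of g "(2 * l + 1) * M"]) (use deg in \<open>simp add: algebra_simps\<close>)
  have "rho (P ^ M * G) = Polynomial.monom (p ^ (2 * M)) ((2 * l + 1) * M) * rho G"
    by (simp only: rho_simps(5,6) rho_P Polynomial.monom_power power_mult)
  also have "Polynomial.monom (p ^ (2 * M)) ((2 * l + 1) * M) = [:p ^ (2 * M):] * Polynomial.monom 1 ((2 * l + 1) * M)"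
    by (simp add: smult_monom)
  finally have "rho F = rho (P ^ M * G)"
    unfolding g G by (simp only: mult.assoc)
  then show ?thesis using dvd_conic_if_rho_eq by blast
qed

text \<open>The number \<open>(2 * l + 1) * (2 * M + 1)\<close> is odd, so the quotient by the power
  of \<open>p\<close> may exceed the degree bound of a restriction by one. The excess term is a
  multiple of t, which is what \<open>B\<close> supplies beyond \<open>A\<close>.\<close>

lemma symb_decomp_odd:
  assumes "F \<in> symb (2 * M + 1)"
  shows "\<exists>G1 G2 H. F = P ^ M * (A * G1 + B * G2) + Q * H"
proof -
  \<comment> \<open>This is the degree of \<open>P ^ M * A\<close> and of \<open>P ^ M * B\<close>;
    twice it is one more than \<open>(2 * l + 1) * (2 * M + 1)\<close>.\<close>
  define D where "D = (2 * l + 1) * M + (l + 1)"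
  from assms obtain g where g: "rho F = [:p ^ (2 * M + 1):] * g"
    and deg: "\<And>d. Polynomial.coeff g d \<noteq> 0 \<Longrightarrow> (2 * l + 1) * (2 * M + 1) + Polynomial.degree (Polynomial.coeff g d) \<le> 2 * d"
    by (elim rho_symb) blast
  have deg': "2 * D + Polynomial.degree (Polynomial.coeff g d) \<le> 2 * d + 1" if "Polynomial.coeff g d \<noteq> 0" for d
    using deg[OF that] by (simp add: D_def algebra_simps)
  \<comment> \<open>The coefficient of the one possible excess power of t. For \<open>d < D\<close>
    the subtraction truncates, but there the coefficient of \<open>g\<close> is 0 and so is
    \<open>top d\<close>.\<close>
  define top where "top d = Polynomial.coeff (Polynomial.coeff g d) (2 * d - 2 * D + 1)" for d
  define g2 where "g2 = (\<Sum>d\<le>Polynomial.degree g. Polynomial.monom (Polynomial.monom (top d) (2 * d - 2 * D)) d)"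
  have coeff_g2: "Polynomial.coeff g2 d = Polynomial.monom (top d) (2 * d - 2 * D)" for d
  proof -
    have "Polynomial.coeff g2 d = (if d \<le> Polynomial.degree g then Polynomial.monom (top d) (2 * d - 2 * D) else 0)"
      by (simp add: g2_def Polynomial.coeff_sum if_distrib sum.delta cong: if_cong)
    then show ?thesis by (simp add: top_def coeff_eq_0)
  qed
  \<comment> \<open>Now \<open>g\<close> is \<open>g1\<close> plus t times \<open>g2\<close>, and
    both parts obey the degree bound of a restriction shifted by \<open>D\<close>.\<close>
  define g1 where "g1 = g - [:[:0, 1:]:] * g2"
  have t: "[:0, 1:] * Polynomial.monom c k = Polynomial.monom c (Suc k)" for c :: 'k and k
    by (simp add: monom_Suc)
  have coeff_g1: "Polynomial.coeff g1 d = Polynomial.coeff g d - Polynomial.monom (top d) (2 * d - 2 * D + 1)" for d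
  proof -
    have "Polynomial.coeff ([:[:0, 1:]:] * g2) d = [:0, 1:] * Polynomial.coeff g2 d"
      by simp
    also have "\<dots> = Polynomial.monom (top d) (2 * d - 2 * D + 1)"
      by (simp only: coeff_g2 t Suc_eq_plus1)
    finally show ?thesis by (simp only: g1_def Polynomial.coeff_diff)
  qed
  have g_le: "D \<le> d" if "Polynomial.coeff g d \<noteq> 0" for d
    using deg'[OF that] by simp
  obtain G2 where G2: "g2 = Polynomial.monom 1 D * rho G2"
  proof (rule rho_lift[of g2 D])
    fix d assume nz: "Polynomial.coeff g2 d \<noteq> 0"
    then have "Polynomial.coeff g d \<noteq> 0" by (auto simp: coeff_g2 top_def)
    then have "D \<le> d" by (rule g_le)
    then show "2 * D + Polynomial.degree (Polynomial.coeff g2 d) \<le> 2 * d"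
      unfolding coeff_g2 using degree_monom_le[of "top d" "2 * d - 2 * D"] by linarith
  qed
  obtain G1 where G1: "g1 = Polynomial.monom 1 D * rho G1"
  proof (rule rho_lift[of g1 D])
    fix d assume nz: "Polynomial.coeff g1 d \<noteq> 0"
    then have nz': "Polynomial.coeff g d \<noteq> 0" by (auto simp: coeff_g1 top_def)
    then have D: "D \<le> d" by (rule g_le)
    have "Polynomial.degree (Polynomial.coeff g1 d) \<le> 2 * d - 2 * D"
    proof (rule degree_le, safe)
      fix i assume i: "2 * d - 2 * D < i"
      show "Polynomial.coeff (Polynomial.coeff g1 d) i = 0"
      proof (cases "i = 2 * d - 2 * D + 1")
        case True
        then show ?thesis by (simp add: coeff_g1 top_def)
      next
        case False
        with i have "Polynomial.degree (Polynomial.coeff g d) < i" using deg'[OF nz'] D by linarith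
        then show ?thesis using False by (simp add: coeff_g1 coeff_eq_0)
      qed
    qed
    with D show "2 * D + Polynomial.degree (Polynomial.coeff g1 d) \<le> 2 * d" by linarith
  qed
  have m: "Polynomial.monom (p ^ 2) (2 * l + 1) ^ M * Polynomial.monom p (l + 1) = [:p ^ (2 * M + 1):] * Polynomial.monom 1 D"
    by (simp add: Polynomial.monom_power mult_monom smult_monom D_def ac_simps flip: power_mult)
  have B: "rho B = [:[:0, 1:]:] * Polynomial.monom p (l + 1)"
    by (simp add: rho_B smult_monom)
  have "rho (P ^ M * (A * G1 + B * G2)) =
      (Polynomial.monom (p ^ 2) (2 * l + 1) ^ M * Polynomial.monom p (l + 1)) * (rho G1 + [:[:0, 1:]:] * rho G2)"
    unfolding rho_simps(3,5,6) rho_P rho_A B by (simp only: distrib_left mult_ac)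
  also have "\<dots> = [:p ^ (2 * M + 1):] * (g1 + [:[:0, 1:]:] * g2)"
    unfolding m G1 G2 by (simp only: distrib_left mult_ac)
  also have "g1 + [:[:0, 1:]:] * g2 = g" by (simp only: g1_def diff_add_cancel)
  finally have "rho F = rho (P ^ M * (A * G1 + B * G2))" by (simp only: g)
  then show ?thesis using dvd_conic_if_rho_eq by blast
qed

subsection \<open>Weighted monomials generating the symbolic powers\<close>

text \<open>The powers of \<open>P\<close> have even weight, and a single factor \<open>A\<close> or
  \<open>B\<close> is what the decomposition at odd weight adds to them.\<close>

definition mon :: "nat \<Rightarrow> 'k poly3 set"
  where "mon N = {Q ^ a * P ^ b * E |a b E e. (E, e) \<in> {(1, 0), (A, 1), (B, 1)} \<and> a + 2 * b + e = N}"

lemma monI: "(E, e) \<in> {(1, 0), (A, 1), (B, 1)} \<Longrightarrow> a + 2 * b + e = N \<Longrightarrow> Q ^ a * P ^ b * E \<in> mon N"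
  unfolding mon_def by blast

lemma monE:
  assumes "x \<in> mon N"
  obtains a b E e where "x = Q ^ a * P ^ b * E" "(E, e) \<in> {(1, 0), (A, 1), (B, 1)}" "a + 2 * b + e = N"
  using assms unfolding mon_def by blast

lemma Q_mult_mon: "x \<in> mon N \<Longrightarrow> Q * x \<in> mon (Suc N)"
  by (erule monE) (auto simp flip: mult.assoc power_Suc intro!: monI)

text \<open>Modulo \<open>Q\<close> the decompositions express \<open>F\<close> by monomials of the
  right weight. The remainder \<open>Q * H\<close> is again in the symbolic power, so
  \<open>H\<close> has weight one less and the induction applies to it. \<open>T\<close> stays
  arbitrary so that the colon ideal can take its place.\<close>

lemma symb_generated:
  assumes "is_ideal T" "mon N \<subseteq> T"
  shows "symb N \<subseteq> T"
  using assms
proof (induction N arbitrary: T)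
  case 0
  have "1 \<in> T" using 0(2) monI[of 1 0 0 0 0] by auto
  then show ?case using ideal_mult_left[OF 0(1), of 1] by auto
next
  case (Suc N)
  have IH: "symb N \<subseteq> {x. Q * x \<in> T}"
    by (rule Suc.IH[OF is_ideal_colon[OF Suc.prems(1)]]) (use Suc.prems(2) Q_mult_mon in auto)
  show ?case
  proof
    fix F assume F: "F \<in> symb (Suc N)"
    \<comment> \<open>The part \<open>K\<close> lies in \<open>T\<close> and in the symbolic power,
      so cancelling \<open>Q\<close> from \<open>F - K\<close> leaves \<open>H\<close> in the
      previous symbolic power.\<close>
    have fin: "F \<in> T" if "F = K + Q * H" "K \<in> T" "K \<in> symb (Suc N)" for K H
    proof -
      have "Q * H \<in> symb (Suc N)"
        using ideal_diff[OF is_ideal_symbolic_power F that(3)] that(1) by simp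
      then have "Q * H \<in> T" using conic_mult_cancel_symb IH by blast
      with that show ?thesis by (simp add: ideal_add Suc.prems(1))
    qed
    have Psym: "P ^ M \<in> symb (2 * M)" for M
      using symbolic_power_pow_mem[OF P_symb] by simp
    show "F \<in> T"
    proof (cases "even (Suc N)")
      case True
      then obtain M where M: "Suc N = 2 * M" by blast
      with F obtain G H where GH: "F = P ^ M * G + Q * H" using symb_decomp_even[of F M] by auto
      have "P ^ M \<in> T" using Suc.prems(2) monI[of 1 0 0 M "Suc N"] M by auto
      with GH show ?thesis
        using Psym[of M] M by (intro fin[OF GH] ideal_mult_right Suc.prems(1) is_ideal_symbolic_power) simp_all
    next
      case False
      then obtain M where M: "Suc N = 2 * M + 1" by (elim oddE)
      with F obtain G1 G2 H where GH: "F = P ^ M * (A * G1 + B * G2) + Q * H"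
        using symb_decomp_odd[of F M] by auto
      have "P ^ M * A \<in> T" "P ^ M * B \<in> T"
        using Suc.prems(2) monI[of A 1 0 M "Suc N"] monI[of B 1 0 M "Suc N"] M by auto
      then have "P ^ M * A * G1 + P ^ M * B * G2 \<in> T"
        by (simp only: ideal_add ideal_mult_right Suc.prems(1))
      moreover have "P ^ M * A \<in> symb (Suc N)" "P ^ M * B \<in> symb (Suc N)"
        unfolding M by (intro symbolic_power_mult_mem Psym A_symb B_symb)+
      then have "P ^ M * A * G1 + P ^ M * B * G2 \<in> symb (Suc N)"
        by (simp only: ideal_add ideal_mult_right is_ideal_symbolic_power)
      ultimately show ?thesis
        by (intro fin[of "P ^ M * A * G1 + P ^ M * B * G2" H]) (simp_all only: GH distrib_left mult.assoc)
    qed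
  qed
qed

text \<open>Factors \<open>P\<close> are taken first, then factors \<open>Q\<close> fill up the
  weight. Since the weight is even, no \<open>P\<close> has to be cut in half. Only if all of these
  fall short is \<open>E\<close> needed, and then the whole monomial has weight
  \<open>2 * c\<close>.\<close>

lemma mon_split:
  assumes x: "x \<in> mon N" and c: "2 * c \<le> N"
  obtains y z where "y \<in> mon (2 * c)" "z \<in> mon (N - 2 * c)" "x = y * z"
proof -
  from x obtain a b E e where x: "x = Q ^ a * P ^ b * E" and E: "(E, e) \<in> {(1, 0), (A, 1), (B, 1)}"
    and N: "a + 2 * b + e = N" by (rule monE)
  have one: "(1, 0) \<in> {(1, 0), (A, 1), (B, 1 :: nat)}" by simp
  consider "c \<le> b" | "b < c" "2 * c \<le> a + 2 * b" | "b < c" "a + 2 * b + e = 2 * c"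
    using E N c by fastforce
  then show thesis
  proof cases
    case 1
    then obtain b' where "b = c + b'" by (auto simp: le_iff_add)
    then show ?thesis
      using x N monI[OF one, of 0 c "2 * c"] monI[OF E, of a b' "N - 2 * c"]
      by (intro that[of "P ^ c" "Q ^ a * P ^ b' * E"]) (simp_all add: power_add mult_ac)
  next
    case 2
    then have "2 * b \<le> 2 * c" by simp
    then obtain k where k: "2 * c = 2 * b + k" by (auto simp only: le_iff_add)
    with 2 obtain a' where a: "a = k + a'" by (auto simp: le_iff_add)
    have "Q ^ k * P ^ b * 1 \<in> mon (2 * c)" "Q ^ a' * P ^ 0 * E \<in> mon (N - 2 * c)"
      using monI[OF one, of k b "2 * c"] monI[OF E, of a' 0 "N - 2 * c"] N k a by simp_all
    then show ?thesis
      by (rule that) (simp add: x a power_add mult_ac)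
  next
    case 3
    with N have "N = 2 * c" by simp
    then show ?thesis
      using x monI[OF E, of a b N] 3 monI[OF one, of 0 0 0] by (intro that[of x 1]) simp_all
  qed
qed

lemma mon_symb: "mon N \<subseteq> symb N"
proof
  fix x assume "x \<in> mon N"
  then obtain a b E e where x: "x = Q ^ a * P ^ b * E" and E: "(E, e) \<in> {(1, 0), (A, 1), (B, 1)}"
    and N: "a + 2 * b + e = N" by (rule monE)
  have "E \<in> symb e" using E A_symb B_symb symb_0 by auto
  then have "Q ^ a * P ^ b * E \<in> symb (1 * a + 2 * b + e)"
    by (intro symbolic_power_mult_mem symbolic_power_pow_mem conic_symb P_symb)
  then show "x \<in> symb N" using x N by simp
qed

abbreviation "M \<equiv> irrelevant_ideal :: 'k poly3 set"

lemma coords_mem: "LX \<in> M" "LY \<in> M" "LZ \<in> M"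
  by (simp_all add: LX_def LY_def LZ_def irrelevant_ideal_lin)

lemma Q_mem: "Q \<in> M"
  unfolding Q_def by (intro ideal_diff ideal_mult_left ideal_irrelevant_ideal coords_mem)

lemma chord_M: "chord \<sigma> \<rho> \<in> M"
  unfolding chord_def by (intro ideal_add ideal_diff ideal_mult_left ideal_irrelevant_ideal coords_mem)

lemma A_mem: "A \<in> M" and B_mem: "B \<in> M"
  unfolding A_def B_def ly_def
  by (intro ideal_mult_left ideal_diff chord_M ideal_irrelevant_ideal coords_mem)+

lemma P_mem: "P \<in> ideal_power M 2"
proof -
  have "polygon \<in> M"
    unfolding polygon_def using l
    by (intro prod_mem_ideal[of _ _ 0] ideal_irrelevant_ideal) (simp_all add: chord_M)
  then have "polygon \<in> ideal_power M 1" "chord (\<tau> (2 * l)) (\<tau> 0) \<in> ideal_power M 1"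
    using ideal_power_1_mem[OF ideal_irrelevant_ideal] chord_M by blast+
  from ideal_power_mult_mem[OF ideal_irrelevant_ideal this] show ?thesis
    by (simp only: P_def one_add_one)
qed

text \<open>Each factor of weight k lies in the k-th power of \<open>M\<close>, so weight left over
  after splitting can be traded for powers of \<open>M\<close>.\<close>

lemma mon_M: "mon N \<subseteq> ideal_power M N"
proof
  fix x assume "x \<in> mon N"
  then obtain a b E e where x: "x = Q ^ a * P ^ b * E" and E: "(E, e) \<in> {(1, 0), (A, 1), (B, 1)}"
    and N: "a + 2 * b + e = N" by (rule monE)
  have "A \<in> ideal_power M 1" "B \<in> ideal_power M 1" "1 \<in> ideal_power M 0"
    using ideal_power_1_mem[OF ideal_irrelevant_ideal] A_mem B_mem by (blast, blast) (simp only: ideal_power_0 UNIV_I)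
  then have "E \<in> ideal_power M e" using E by blast
  then have "Q ^ a * P ^ b * E \<in> ideal_power M (1 * a + 2 * b + e)"
    by (intro ideal_power_mult_mem ideal_power_pow_mem ideal_irrelevant_ideal P_mem ideal_power_1_mem Q_mem)
  then show "x \<in> ideal_power M N" using x N by (simp only: mult_1)
qed

text \<open>Dropping one side of the polygon keeps it through all points, so even a pure power of \<open>P\<close>
  splits off a linear form.\<close>

lemma mon_even_split:
  assumes "x \<in> mon (2 * Suc c)"
  obtains y z where "y \<in> M" "z \<in> symb (2 * c + 1)" "x = y * z"
proof -
  from assms obtain a b E e where x: "x = Q ^ a * P ^ b * E" and E: "(E, e) \<in> {(1, 0), (A, 1), (B, 1)}"
    and N: "a + 2 * b + e = 2 * Suc c" by (rule monE)
  show thesis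
  proof (cases a)
    case 0
    \<comment> \<open>Without a factor \<open>Q\<close>, the even weight excludes \<open>A\<close>
      and \<open>B\<close>, leaving a pure power of \<open>P\<close>.\<close>
    with N have "even e" by presburger
    with E have E1: "E = 1" "e = 0" by auto
    with 0 N have b: "b = Suc c" by simp
    have "P ^ c * polygon \<in> symb (2 * c + 1)"
      by (intro symbolic_power_mult_mem symbolic_power_pow_mem P_symb polygon_symb)
    moreover have "x = chord (\<tau> (2 * l)) (\<tau> 0) * (P ^ c * polygon)"
      by (simp add: x 0 E1 b P_def)
    ultimately show thesis using chord_M by (intro that)
  next
    case (Suc a')
    have "Q ^ a' * P ^ b * E \<in> symb (2 * c + 1)"
      using mon_symb monI[OF E, of a' b "2 * c + 1"] N Suc by auto
    moreover have "x = Q * (Q ^ a' * P ^ b * E)" by (simp add: x Suc)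
    ultimately show thesis using Q_mem by (intro that)
  qed
qed

section \<open>Containment in products of powers of \<open>M\<close> and of a symbolic power\<close>

definition T :: "nat \<Rightarrow> nat \<Rightarrow> nat \<Rightarrow> 'k poly3 set"
  where "T m s t = ideal_power M s \<cdot>\<^bsub>coord_ring\<^esub> ideal_power (symb m) t"

lemma is_ideal_T: "is_ideal (T m s t)"
  unfolding T_def by (intro is_ideal_prod is_ideal_power ideal_irrelevant_ideal is_ideal_symbolic_power)

text \<open>Multiplication by \<open>x\<close> is checked on products of the two factors only; the
  colon ideal takes care of sums.\<close>

lemma T_mult_M:
  assumes "x \<in> M" "z \<in> T m s t"
  shows "x * z \<in> T m (Suc s) t"
proof -
  have "T m s t \<subseteq> {z. x * z \<in> T m (Suc s) t}"
    unfolding T_def[of m s t]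
  proof (rule ideal_prod_subsetI[OF is_ideal_colon[OF is_ideal_T]], safe)
    fix a b assume ab: "a \<in> ideal_power M s" "b \<in> ideal_power (symb m) t"
    have "a * x * b \<in> T m (Suc s) t"
      unfolding T_def ideal_power_Suc by (intro ideal_prod_memI ab assms(1))
    then show "x * (a * b) \<in> T m (Suc s) t" by (simp only: mult_ac)
  qed
  with assms(2) show ?thesis by blast
qed

lemma T_mult_symb:
  assumes "y \<in> symb m" "z \<in> T m s t"
  shows "y * z \<in> T m s (Suc t)"
proof -
  have "T m s t \<subseteq> {z. y * z \<in> T m s (Suc t)}"
    unfolding T_def[of m s t]
  proof (rule ideal_prod_subsetI[OF is_ideal_colon[OF is_ideal_T]], safe)
    fix a b assume ab: "a \<in> ideal_power M s" "b \<in> ideal_power (symb m) t"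
    have "a * (b * y) \<in> T m s (Suc t)"
      unfolding T_def ideal_power_Suc by (intro ideal_prod_memI ab assms(1))
    then show "y * (a * b) \<in> T m s (Suc t)" by (simp only: mult_ac)
  qed
  with assms(2) show ?thesis by blast
qed

lemma power_M_subset_T: "ideal_power M s \<subseteq> T m s 0"
proof
  fix x assume "x \<in> ideal_power M s"
  then have "x * 1 \<in> T m s 0" unfolding T_def ideal_power_0 by (intro ideal_prod_memI) auto
  then show "x \<in> T m s 0" by simp
qed

text \<open>Weight \<open>2 * c\<close> is split off \<open>t\<close> times, each time giving an
  element of the symbolic power; the remaining weight \<open>s\<close> goes into the power of
  \<open>M\<close>.\<close>

lemma mon_subset_T_even:
  assumes "c \<ge> 1"
  shows "mon (t * (2 * c) + s) \<subseteq> T (2 * c) s t"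
proof (induction t)
  case 0
  show ?case using mon_M power_M_subset_T by (simp only: mult_0 add_0) blast
next
  case (Suc t)
  show ?case
  proof
    fix x assume x: "x \<in> mon (Suc t * (2 * c) + s)"
    have "2 * c \<le> Suc t * (2 * c) + s" by (simp add: trans_le_add1)
    then obtain y z where "y \<in> mon (2 * c)" "z \<in> mon (Suc t * (2 * c) + s - 2 * c)" "x = y * z"
      by (rule mon_split[OF x])
    then show "x \<in> T (2 * c) s (Suc t)"
      using Suc mon_symb by (auto intro!: T_mult_symb)
  qed
qed

text \<open>Here \<open>m + 1\<close> is even, so this weight can be split off, and each such piece
  gives one factor from \<open>M\<close> and one from the symbolic power. The parameter
  \<open>r\<close> allows for the last, incomplete piece.\<close>

lemma mon_subset_T_odd:
  fixes c :: nat
  defines "m \<equiv> 2 * c + 1"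
  assumes "mon r \<subseteq> T m s0 t0"
  shows "mon (t * (m + 1) + r) \<subseteq> T m (t + s0) (t + t0)"
proof (induction t)
  case 0
  then show ?case using assms by simp
next
  case (Suc t)
  show ?case
  proof
    fix x assume x: "x \<in> mon (Suc t * (m + 1) + r)"
    have "2 * Suc c \<le> Suc t * (m + 1) + r" by (simp add: m_def trans_le_add1)
    then obtain y z where yz: "y \<in> mon (2 * Suc c)" "z \<in> mon (Suc t * (m + 1) + r - 2 * Suc c)" "x = y * z"
      by (rule mon_split[OF x])
    have "Suc t * (m + 1) + r - 2 * Suc c = t * (m + 1) + r" by (simp add: m_def)
    with yz(2) Suc have z: "z \<in> T m (t + s0) (t + t0)" by auto
    from yz(1) obtain a b where ab: "a \<in> M" "b \<in> symb m" "y = a * b"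
      unfolding m_def by (rule mon_even_split)
    have "a * (b * z) \<in> T m (Suc (t + s0)) (Suc (t + t0))"
      by (intro T_mult_M T_mult_symb ab z)
    then show "x \<in> T m (Suc t + s0) (Suc t + t0)" by (simp add: yz(3) ab(3) mult.assoc)
  qed
qed

theorem symb_containment:
  assumes m: "m \<ge> 1" and t: "t \<ge> 1"
  shows "symb (t * (m + 1)) \<subseteq> T m t t" and "symb (t * (m + 1) - 1) \<subseteq> T m (t - 1) t"
proof -
  have "mon (t * (m + 1)) \<subseteq> T m t t \<and> mon (t * (m + 1) - 1) \<subseteq> T m (t - 1) t"
  proof (cases "even m")
    case True
    then obtain c where c: "m = 2 * c" by blast
    \<comment> \<open>Besides \<open>t\<close> pieces of weight \<open>m\<close> there remains
      weight \<open>t\<close>, respectively \<open>t - 1\<close>, for \<open>M\<close>.\<close>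
    have e: "t * (m + 1) = t * (2 * c) + t" "t * (m + 1) - 1 = t * (2 * c) + (t - 1)"
      using t by (simp_all add: c algebra_simps)
    have "1 \<le> c" using m c by simp
    then show ?thesis
      unfolding e(2) unfolding e(1) unfolding c by (intro conjI mon_subset_T_even)
  next
    case False
    then obtain c where c: "m = 2 * c + 1" by (elim oddE)
    obtain t' where t': "t = Suc t'" using t by (cases t) auto
    have "mon 0 \<subseteq> T m 0 0"
      using mon_M[of 0] power_M_subset_T[of 0 m] by blast
    \<comment> \<open>The weight \<open>t * (m + 1) - 1\<close> consists of \<open>t - 1\<close>
      pieces of weight \<open>m + 1\<close> and one of weight \<open>m\<close>, which lies in the
      symbolic power without a factor from \<open>M\<close>.\<close>
    moreover have "mon m \<subseteq> T m 0 1"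
    proof
      fix x assume "x \<in> mon m"
      then have "x * 1 \<in> T m 0 (Suc 0)"
        using power_M_subset_T[of 0 m] mon_symb by (intro T_mult_symb) (auto simp only: ideal_power_0)
      then show "x \<in> T m 0 1" by simp
    qed
    ultimately show ?thesis
      using mon_subset_T_odd[of 0 c 0 0 t] mon_subset_T_odd[of m c 0 1 t'] by (simp add: c t' add_ac)
  qed
  then show "symb (t * (m + 1)) \<subseteq> T m t t" "symb (t * (m + 1) - 1) \<subseteq> T m (t - 1) t"
    using symb_generated[OF is_ideal_T] by blast+
qed

lemma T_subset_power: "T m s t \<subseteq> ideal_power (symb m) t"
  unfolding T_def
  by (rule ideal_prod_subsetI) (intro is_ideal_power ideal_mult_left is_ideal_symbolic_power; assumption)+

end

section \<open>Parametrising a smooth conic\<close>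

definition qform :: "(3 \<Rightarrow> 3 \<Rightarrow> 'k::comm_ring_1) \<Rightarrow> 'k ^ 3 \<Rightarrow> 'k"
  where "qform q x = (\<Sum>i\<in>UNIV. \<Sum>j\<in>UNIV. q i j * (x $ i * x $ j))"

text \<open>The matrix \<open>q\<close> need not be symmetric, hence the sum of both entries.
  Pairing with \<open>y\<close> gives the polar form of the quadratic form.\<close>

definition grad :: "(3 \<Rightarrow> 3 \<Rightarrow> 'k::comm_ring_1) \<Rightarrow> 'k ^ 3 \<Rightarrow> 'k ^ 3"
  where "grad q x = (\<chi> i. \<Sum>j\<in>UNIV. (q i j + q j i) * x $ j)"

lemma grad_nth: "grad q x $ i = (\<Sum>j\<in>UNIV. (q i j + q j i) * x $ j)"
  by (simp add: grad_def)

lemma exponent_degree_2: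
  fixes a :: "3 \<Rightarrow>\<^sub>0 nat"
  assumes "(\<Sum>i\<in>UNIV. Poly_Mapping.lookup a i) = 2"
  shows "\<exists>r s. a = Poly_Mapping.single r 1 + Poly_Mapping.single s 1"
proof -
  have split: "\<exists>r b. a = Poly_Mapping.single r 1 + b \<and> (\<Sum>i\<in>UNIV. Poly_Mapping.lookup b i) = k"
    if sum: "(\<Sum>i\<in>UNIV. Poly_Mapping.lookup a i) = Suc k" for a :: "3 \<Rightarrow>\<^sub>0 nat" and k
  proof -
    obtain r where r: "Poly_Mapping.lookup a r \<noteq> 0"
      using sum by (metis sum.neutral nat.distinct(1))
    define b where "b = a - Poly_Mapping.single r 1"
    have a: "a = Poly_Mapping.single r 1 + b"
      using r by (intro poly_mapping_eqI) (auto simp: b_def lookup_add lookup_minus lookup_single when_def)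
    have "(\<Sum>i\<in>UNIV. Poly_Mapping.lookup (Poly_Mapping.single r (1::nat)) i) = 1"
      by (simp add: lookup_single when_def)
    then have "(\<Sum>i\<in>UNIV. Poly_Mapping.lookup b i) = k"
      using sum by (subst (asm) a) (simp add: lookup_add sum.distrib)
    with a show ?thesis by blast
  qed
  from split[of a 1] assms obtain r b where b: "a = Poly_Mapping.single r 1 + b" "(\<Sum>i\<in>UNIV. Poly_Mapping.lookup b i) = 1"
    by auto
  from split[of b 0] b(2) obtain s c where c: "b = Poly_Mapping.single s 1 + c" "(\<Sum>i\<in>UNIV. Poly_Mapping.lookup c i) = 0"
    by auto
  then have "c = 0" by (intro poly_mapping_eqI) simp
  with b c show ?thesis by auto
qed

text \<open>One matrix has to represent both the monomial and its partial derivatives, so that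
  smoothness can be stated through \<open>grad\<close>.\<close>

lemma monomial_degree_2:
  fixes a :: "3 \<Rightarrow>\<^sub>0 nat" and c :: "'k::comm_ring_1"
  assumes "(\<Sum>i\<in>UNIV. Poly_Mapping.lookup a i) = 2"
  shows "\<exists>q. (\<forall>x. c * (\<Prod>i\<in>UNIV. (x $ i) ^ Poly_Mapping.lookup a i) = qform q x) \<and>
    (\<forall>x i. of_nat (Poly_Mapping.lookup a i) * c * (\<Prod>j\<in>UNIV. (x $ j) ^ Poly_Mapping.lookup (a - Poly_Mapping.single i 1) j) = grad q x $ i)"
proof -
  from exponent_degree_2[OF assms] obtain r s where a: "a = Poly_Mapping.single r 1 + Poly_Mapping.single s 1" by blast
  \<comment> \<open>The whole coefficient sits in one entry; symmetrising would require division by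
    2.\<close>
  define q where "q i j = (if i = r then if j = s then c else 0 else 0)" for i j
  have pr: "(\<Prod>j\<in>UNIV. (x $ j) ^ Poly_Mapping.lookup (Poly_Mapping.single i (1::nat)) j) = x $ i" for x :: "'k ^ 3" and i
    by (rule prod_power_lookup_single)
  have "c * (\<Prod>i\<in>UNIV. (x $ i) ^ Poly_Mapping.lookup a i) = qform q x" for x
  proof -
    have "(\<Prod>i\<in>UNIV. (x $ i) ^ Poly_Mapping.lookup a i) = x $ r * x $ s"
      unfolding a lookup_add power_add prod.distrib pr ..
    moreover have "qform q x = c * (x $ r * x $ s)"
      unfolding qform_def q_def
      by (simp add: if_distrib[of "\<lambda>y. y * _"] sum.delta cong: if_cong)
        (subst sum.swap, simp)
    ultimately show ?thesis by simp
  qed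
  moreover have "of_nat (Poly_Mapping.lookup a i) * c * (\<Prod>j\<in>UNIV. (x $ j) ^ Poly_Mapping.lookup (a - Poly_Mapping.single i 1) j) = grad q x $ i" for x i
  proof -
    have g: "grad q x $ i = (if i = r then c * x $ s else 0) + (if i = s then c * x $ r else 0)"
      unfolding grad_nth q_def distrib_right sum.distrib
      by (simp add: if_distrib[of "\<lambda>y. y * _"] sum.delta cong: if_cong)
    have ar: "a - Poly_Mapping.single r 1 = Poly_Mapping.single s 1" "a - Poly_Mapping.single s 1 = Poly_Mapping.single r 1"
      unfolding a by simp_all
    have la: "Poly_Mapping.lookup a i = (if i = r then 1 else 0) + (if i = s then 1 else 0)"
      by (simp add: a lookup_add lookup_single when_def)
    consider "i = r" "i = s" | "i = r" "i \<noteq> s" | "i \<noteq> r" "i = s" | "i \<noteq> r" "i \<noteq> s" by blast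
    then show ?thesis
    proof cases
      case 1
      then show ?thesis using g la ar pr[of x s] by (simp add: algebra_simps)
    next
      case 2
      then show ?thesis using g la ar pr[of x s] by simp
    next
      case 3
      then show ?thesis using g la ar pr[of x r] by simp
    next
      case 4
      then show ?thesis using g la by simp
    qed
  qed
  ultimately show ?thesis by blast
qed

lemma quadratic_form_expansion:
  fixes Q :: "'k::comm_ring_1 poly3"
  assumes "homogeneous 2 Q"
  obtains q where "\<And>x. poly_eval Q x = qform q x" "\<And>x i. poly_eval (partial_deriv i Q) x = grad q x $ i"
proof -
  interpret coeff_hom "\<lambda>c :: 'k. c" by (rule coeff_hom_id)
  let ?K = "Poly_Mapping.keys Q" and ?c = "Poly_Mapping.lookup Q"
  have "\<forall>a\<in>?K. \<exists>q. (\<forall>x. ?c a * (\<Prod>i\<in>UNIV. (x $ i) ^ Poly_Mapping.lookup a i) = qform q x) \<and>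
    (\<forall>x i. of_nat (Poly_Mapping.lookup a i) * ?c a * (\<Prod>j\<in>UNIV. (x $ j) ^ Poly_Mapping.lookup (a - Poly_Mapping.single i 1) j) = grad q x $ i)"
    using assms by (intro ballI monomial_degree_2) (simp add: homogeneous_def)
  then obtain q where q: "\<forall>a\<in>?K. (\<forall>x. ?c a * (\<Prod>i\<in>UNIV. (x $ i) ^ Poly_Mapping.lookup a i) = qform (q a) x) \<and>
    (\<forall>x i. of_nat (Poly_Mapping.lookup a i) * ?c a * (\<Prod>j\<in>UNIV. (x $ j) ^ Poly_Mapping.lookup (a - Poly_Mapping.single i 1) j) = grad (q a) x $ i)"
    by (rule bchoice[THEN exE])
  define q' where "q' i j = (\<Sum>a\<in>?K. q a i j)" for i j
  show thesis
  proof
    fix x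
    have "poly_eval Q x = (\<Sum>a\<in>?K. qform (q a) x)"
      unfolding poly_eval_def using q by (intro sum.cong) auto
    also have "\<dots> = qform q' x"
      unfolding qform_def q'_def sum_distrib_right
      by (subst sum.swap) (intro sum.cong refl sum.swap)
    finally show "poly_eval Q x = qform q' x" .
    fix i
    have "poly_eval (partial_deriv i Q) x = (\<Sum>a\<in>?K. grad (q a) x $ i)"
      unfolding poly_eval_subst partial_deriv_def subst_sum subst_single using q by (intro sum.cong) auto
    also have "\<dots> = grad q' x $ i"
      unfolding grad_nth q'_def sum.distrib[symmetric] sum_distrib_right
      by (rule sum.swap)
    finally show "poly_eval (partial_deriv i Q) x = grad q' x $ i" .
  qed
qed

section \<open>Polar forms and cross products\<close>

lemma dot_commute: "dot a b = dot b a"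
  by (simp add: dot_def mult.commute)

lemma dot_grad: "dot (grad q x) y = (\<Sum>i\<in>UNIV. \<Sum>j\<in>UNIV. q i j * (x $ i * y $ j + y $ i * x $ j))"
proof -
  have "dot (grad q x) y = (\<Sum>i\<in>UNIV. \<Sum>j\<in>UNIV. q i j * (x $ j * y $ i)) + (\<Sum>i\<in>UNIV. \<Sum>j\<in>UNIV. q j i * (x $ j * y $ i))"
    unfolding dot_def grad_nth sum_distrib_right sum.distrib[symmetric]
    by (intro sum.cong refl) (simp add: algebra_simps)
  also have "(\<Sum>i\<in>UNIV. \<Sum>j\<in>UNIV. q j i * (x $ j * y $ i)) = (\<Sum>i\<in>UNIV. \<Sum>j\<in>UNIV. q i j * (x $ i * y $ j))"
    by (rule sum.swap)
  finally show ?thesis by (simp add: algebra_simps sum.distrib)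
qed

lemma dot_grad_commute: "dot (grad q x) y = dot (grad q y) x"
  unfolding dot_grad by (simp add: algebra_simps)

text \<open>Euler's identity in degree two.\<close>

lemma dot_grad_self: "dot (grad q x) x = 2 * qform q x"
  unfolding dot_grad qform_def by (simp add: sum_distrib_left algebra_simps)

lemma qform_add: "qform q (x + y) = qform q x + qform q y + dot (grad q x) y"
  unfolding dot_grad qform_def by (simp add: algebra_simps sum.distrib)

lemma qform_scale: "qform q (r *s x) = r\<^sup>2 * qform q x"
  unfolding qform_def by (simp add: sum_distrib_left algebra_simps power2_eq_square)

lemma grad_scale: "grad q (r *s x) = r *s grad q x"
  by (simp add: vec_eq_iff grad_nth sum_distrib_left algebra_simps)

lemma grad_add: "grad q (x + y) = grad q x + grad q y"
  by (simp add: vec_eq_iff grad_nth sum.distrib distrib_left)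

lemma dot_axis: "dot a (axis j 1) = a $ j"
proof -
  have "dot a (axis j 1) = (\<Sum>i\<in>UNIV. if i = j then a $ j else 0)"
    unfolding dot_def by (rule sum.cong) (auto simp: axis_def)
  then show ?thesis by simp
qed

definition cross :: "'k::comm_ring_1 ^ 3 \<Rightarrow> 'k ^ 3 \<Rightarrow> 'k ^ 3"
  where "cross a b = (\<chi> i. if i = 1 then a $ 2 * b $ 3 - a $ 3 * b $ 2
    else if i = 2 then a $ 3 * b $ 1 - a $ 1 * b $ 3 else a $ 1 * b $ 2 - a $ 2 * b $ 1)"

lemma cross_nth: "cross a b $ 1 = a $ 2 * b $ 3 - a $ 3 * b $ 2" "cross a b $ 2 = a $ 3 * b $ 1 - a $ 1 * b $ 3"
  "cross a b $ 3 = a $ 1 * b $ 2 - a $ 2 * b $ 1"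
  by (simp_all add: cross_def)

lemma dot_cross_self: "dot a (cross a b) = 0" "dot b (cross a b) = 0"
  unfolding dot_def sum_3 cross_nth by (simp_all add: algebra_simps)

text \<open>The Binet-Cauchy identity.\<close>

lemma dot_cross_cross: "dot (cross a b) (cross c d) = dot a c * dot b d - dot a d * dot b c"
  unfolding dot_def sum_3 cross_nth by (simp add: algebra_simps)

text \<open>By a triple product identity the two sides differ by the cross product of
  \<open>p\<close> with a combination of \<open>a\<close> and \<open>b\<close> whose coefficients
  are the vanishing products with \<open>y\<close>. If \<open>dot p (cross a b) = 1\<close>, then
  \<open>y\<close> is a multiple of \<open>cross a b\<close>.\<close>

lemma orthogonal_to_both:
  assumes "dot a y = 0" "dot b y = 0"
  shows "dot p (cross a b) *s y = dot p y *s cross a b"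
proof -
  have "dot p (cross a b) *s y - dot p y *s cross a b = cross p (dot b y *s a - dot a y *s b)"
    unfolding vec_eq_iff forall_3 vector_minus_component vector_smult_component cross_nth dot_def sum_3
    by (simp add: algebra_simps)
  then have "dot p (cross a b) *s y - dot p y *s cross a b = 0"
    by (auto simp: assms vec_eq_iff forall_3 cross_nth)
  then show ?thesis by simp
qed

text \<open>The vectors \<open>u\<close> and \<open>w\<close> span a hyperbolic pair of isotropic
  vectors, and \<open>v\<close> is the pole of the line joining them, scaled by a square root so
  that the form takes the value -1.\<close>

lemma conic_frame_exists:
  fixes q :: "3 \<Rightarrow> 3 \<Rightarrow> 'k::{alg_closed_field, field_char_0}"
  assumes smooth: "\<And>x. x \<noteq> 0 \<Longrightarrow> qform q x = 0 \<Longrightarrow> grad q x \<noteq> 0"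
    and w: "w \<noteq> 0" "qform q w = 0"
  obtains u v \<xi> \<eta> \<zeta> where "conic_frame u v w \<xi> \<eta> \<zeta>"
    and "\<And>a b c. qform q (a *s u + b *s v + c *s w) = a * c - b\<^sup>2"
proof -
  define \<xi> where "\<xi> = grad q w"
  have "\<xi> \<noteq> 0" using smooth w by (simp add: \<xi>_def)
  then obtain j where j: "\<xi> $ j \<noteq> 0" by (auto simp: vec_eq_iff)
  define e where "e = inverse (\<xi> $ j) *s axis j 1"
  have e: "dot \<xi> e = 1" using j by (simp add: e_def dot_simps dot_axis)
  have ww: "dot \<xi> w = 0" using w by (simp add: \<xi>_def dot_grad_self)
  \<comment> \<open>The multiple of \<open>w\<close> is chosen to make \<open>u\<close> isotropic:
    the polar form of \<open>e\<close> and \<open>w\<close> is 1 and \<open>w\<close> itself is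
    isotropic.\<close>
  define u where "u = e + (- qform q e) *s w"
  have \<xi>u: "dot \<xi> u = 1" by (simp add: u_def dot_simps e ww)
  have "dot (grad q e) w = 1" using e by (simp add: \<xi>_def dot_grad_commute)
  then have uu: "qform q u = 0"
    by (simp only: u_def qform_add qform_scale w dot_simps) simp
  define \<zeta> where "\<zeta> = grad q u"
  have \<zeta>u: "dot \<zeta> u = 0" using uu by (simp add: \<zeta>_def dot_grad_self)
  have \<zeta>w: "dot \<zeta> w = 1" using \<xi>u by (simp add: \<zeta>_def \<xi>_def dot_grad_commute)
  \<comment> \<open>The intersection of the tangents at \<open>u\<close> and
    \<open>w\<close>.\<close>
  define v0 where "v0 = cross \<xi> \<zeta>"
  have v0: "dot \<xi> v0 = 0" "dot \<zeta> v0 = 0" by (simp_all add: v0_def dot_cross_self)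
  have p: "dot (cross u w) (cross \<xi> \<zeta>) = 1"
    by (simp add: dot_cross_cross dot_commute[of u] dot_commute[of w] \<xi>u \<zeta>u \<zeta>w ww)
  have decomp: "\<exists>k. y = dot \<xi> y *s u + k *s v0 + dot \<zeta> y *s w" for y
  proof -
    let ?y = "y - dot \<xi> y *s u - dot \<zeta> y *s w"
    have "dot \<xi> ?y = 0" "dot \<zeta> ?y = 0" by (simp_all add: dot_simps \<xi>u \<zeta>u \<zeta>w ww)
    from orthogonal_to_both[OF this, of "cross u w"] have "?y = dot (cross u w) ?y *s v0"
      by (simp only: p vec.scale_one v0_def)
    then have "y = dot \<xi> y *s u + dot (cross u w) ?y *s v0 + dot \<zeta> y *s w"
      by (metis add.commute add.left_commute diff_add_cancel)
    then show ?thesis by blast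
  qed
  have v0w: "dot (grad q v0) w = 0" "dot (grad q v0) u = 0"
    using v0 by (simp_all add: dot_grad_commute[of q v0] \<xi>_def \<zeta>_def)
  \<comment> \<open>Otherwise \<open>v0\<close> would be a singular point: its gradient annihilates
    \<open>u\<close>, \<open>w\<close> and \<open>v0\<close>, hence every vector.\<close>
  have v0_qform: "qform q v0 \<noteq> 0"
  proof
    assume z: "qform q v0 = 0"
    have "dot (cross u w) v0 \<noteq> 0" using p by (simp add: v0_def)
    then have "v0 \<noteq> 0" by (auto simp: dot_def)
    with z smooth have "grad q v0 \<noteq> 0" by blast
    moreover have "dot (grad q v0) y = 0" for y
    proof -
      obtain k where y: "y = dot \<xi> y *s u + k *s v0 + dot \<zeta> y *s w" using decomp by blast
      show ?thesis by (subst y) (simp add: dot_simps v0w dot_grad_self z)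
    qed
    then have "grad q v0 $ i = 0" for i by (metis dot_axis)
    then have "grad q v0 = 0" by (simp add: vec_eq_iff)
    ultimately show False by blast
  qed
  have "\<exists>r. poly [:inverse (qform q v0), 0, 1:] r = 0"
    by (rule alg_closed_imp_poly_has_root) simp
  then obtain r where "r * r = - inverse (qform q v0)" by (auto simp: eq_neg_iff_add_eq_0 add.commute)
  then have r: "r\<^sup>2 * qform q v0 = - 1" using v0_qform by (simp add: power2_eq_square)
  then have r0: "r \<noteq> 0" by auto
  define v where "v = r *s v0"
  have vv: "qform q v = - 1" using r by (simp add: v_def qform_scale)
  \<comment> \<open>By Euler's identity the gradient at \<open>v\<close> pairs with \<open>v\<close>
    to -2, hence the factor -1/2.\<close>
  define \<eta> where "\<eta> = (- 1 / 2) *s grad q v"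
  have \<eta>: "dot \<eta> v = 1" "dot \<eta> u = 0" "dot \<eta> w = 0"
  proof -
    have "dot \<eta> x = (- 1 / 2) * dot (grad q v) x" for x by (simp only: \<eta>_def dot_simps)
    then show "dot \<eta> v = 1" "dot \<eta> u = 0" "dot \<eta> w = 0"
      by (simp_all add: dot_grad_self vv) (simp_all add: v_def grad_scale dot_simps v0w)
  qed
  have \<xi>v: "dot \<xi> v = 0" "dot \<zeta> v = 0" using v0 by (simp_all add: v_def dot_simps)
  have frame: "conic_frame u v w \<xi> \<eta> \<zeta>"
  proof
    fix i j :: 3
    let ?y = "axis j 1 :: 'k ^ 3"
    \<comment> \<open>Entry \<open>i\<close> of the frame expansion of the \<open>j\<close>-th unit
      vector is the required identity.\<close>
    obtain k where k: "?y = dot \<xi> ?y *s u + k *s v0 + dot \<zeta> ?y *s w" using decomp by blast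
    then have y: "?y = dot \<xi> ?y *s u + (k / r) *s v + dot \<zeta> ?y *s w"
      using r0 by (simp add: v_def)
    have "dot \<eta> ?y = k / r"
      by (subst y) (simp add: dot_simps \<eta>)
    with y have "?y = dot \<xi> ?y *s u + dot \<eta> ?y *s v + dot \<zeta> ?y *s w" by simp
    then have "?y $ i = (dot \<xi> ?y *s u + dot \<eta> ?y *s v + dot \<zeta> ?y *s w) $ i" by (rule arg_cong)
    then show "u $ i * \<xi> $ j + v $ i * \<eta> $ j + w $ i * \<zeta> $ j = (if i = j then 1 else 0)"
      unfolding dot_axis by (simp add: axis_def mult.commute)
  qed (simp_all add: \<xi>u ww \<zeta>u \<zeta>w \<eta> \<xi>v)
  moreover have "qform q (a *s u + b *s v + c *s w) = a * c - b\<^sup>2" for a b c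
  proof -
    have "dot (grad q u) v = 0" "dot (grad q u) w = 1" "dot (grad q v) w = 0"
      using \<xi>v \<zeta>w v0w by (simp_all add: \<zeta>_def v_def grad_scale dot_simps)
    then show ?thesis
      by (simp add: qform_add qform_scale uu vv w grad_add grad_scale dot_simps)
  qed
  ultimately show thesis by (rule that)
qed

section \<open>Projective points and the choice of infinity\<close>

lemma proj_plane_span:
  assumes "x \<noteq> (0 :: 'k::field ^ 3)"
  shows "vec.span {x} \<in> proj_plane"
  using assms by (simp add: proj_plane_def vec.subspace_span)

lemma proj_planeE:
  assumes "P \<in> proj_plane"
  obtains x where "x \<noteq> (0 :: 'k::field ^ 3)" "P = vec.span {x}"
proof -
  from assms have P: "vec.subspace P" "vec.dim P = 1" by (auto simp: proj_plane_def)
  obtain B where B: "B \<subseteq> P" "vec.independent B" "P \<subseteq> vec.span B" "card B = vec.dim P"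
    by (rule vec.basis_exists)
  then obtain x where x: "B = {x}" using P(2) by (auto simp: card_1_singleton_iff)
  have "x \<noteq> 0" using B(2) x vec.dependent_zero[of B] by auto
  moreover have "P = vec.span {x}"
    using B P(1) x vec.span_minimal[of B P] by auto
  ultimately show thesis by (rule that)
qed

lemma span_scale_eq:
  assumes "a \<noteq> 0"
  shows "vec.span {a *s x} = vec.span {x :: 'k::field ^ 3}"
proof -
  have "k *s x \<in> range (\<lambda>k. k *s (a *s x))" for k
    using assms by (intro image_eqI[of _ _ "k / a"]) auto
  then show ?thesis by (auto simp: vec.span_singleton)
qed

context conic_frame
begin

lemma pt_nonzero: "pt \<tau> \<noteq> 0"
proof
  assume "pt \<tau> = 0"
  then have "dot \<xi> (pt \<tau>) = 0" by (simp add: dot_def)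
  then show False by (simp add: pt_def dot_simps dual)
qed

lemma inj_span_pt: "inj (\<lambda>\<tau>. vec.span {pt \<tau>})"
proof (rule injI)
  fix \<sigma> \<tau> assume "vec.span {pt \<sigma>} = vec.span {pt \<tau>}"
  then have "pt \<sigma> \<in> vec.span {pt \<tau>}" using vec.span_base[of "pt \<sigma>" "{pt \<sigma>}"] by simp
  then obtain k where k: "pt \<sigma> = k *s pt \<tau>" by (auto simp: vec.span_singleton)
  have "dot \<xi> (pt \<sigma>) = 1" "dot \<xi> (pt \<tau>) = 1" "dot \<eta> (pt \<sigma>) = \<sigma>" "dot \<eta> (pt \<tau>) = \<tau>"
    by (simp_all add: pt_def dot_simps dual)
  then show "\<sigma> = \<tau>" unfolding k by (simp add: dot_simps)
qed

end

text \<open>A first frame, based at a point of \<open>S\<close>, shows only that the conic has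
  infinitely many points. A point outside \<open>S\<close> then becomes infinity of the second
  frame, so that all of \<open>S\<close> is reached by the parametrisation.\<close>

lemma smooth_conic_frame:
  fixes C S :: "('k::{alg_closed_field, field_char_0} ^ 3) set set"
  assumes C: "smooth_conic C" and S: "S \<subseteq> C" "finite S" "S \<noteq> {}"
  obtains u v w \<xi> \<eta> \<zeta> where "conic_frame u v w \<xi> \<eta> \<zeta>"
    and "\<And>P. P \<in> S \<Longrightarrow> \<exists>\<tau>. P = vec.span {conic_frame.pt u v w \<tau>}"
proof -
  from C obtain Q where Q: "homogeneous 2 Q" "C = {P \<in> proj_plane. vanishes_at Q P}"
    and sm: "\<And>P. P \<in> C \<Longrightarrow> \<exists>i. \<not> vanishes_at (partial_deriv i Q) P"
    unfolding smooth_conic_def by blast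
  obtain q where q: "\<And>x. poly_eval Q x = qform q x" "\<And>x i. poly_eval (partial_deriv i Q) x = grad q x $ i"
    using quadratic_form_expansion[OF Q(1)] by metis
  have mem_C: "vec.span {x} \<in> C" if "x \<noteq> 0" "qform q x = 0" for x
    using that Q(2) proj_plane_span by (auto simp: vanishes_at_def q vec.span_singleton qform_scale)
  have C_E: "\<exists>x. x \<noteq> 0 \<and> qform q x = 0 \<and> P = vec.span {x}" if P: "P \<in> C" for P
  proof -
    from P Q(2) obtain x where x: "x \<noteq> 0" "P = vec.span {x}" by (auto elim: proj_planeE)
    moreover have "qform q x = 0" using P Q(2) x by (auto simp: vanishes_at_def q vec.span_base)
    ultimately show ?thesis by blast
  qed
  have smooth: "grad q x \<noteq> 0" if "x \<noteq> 0" "qform q x = 0" for x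
  proof
    assume "grad q x = 0"
    then have "vanishes_at (partial_deriv i Q) (vec.span {x})" for i
      by (auto simp: vanishes_at_def q vec.span_singleton grad_scale)
    then show False using sm mem_C that by blast
  qed
  obtain w0 where w0: "w0 \<noteq> 0" "qform q w0 = 0" using S C_E by blast
  obtain u0 v0 \<xi>0 \<eta>0 \<zeta>0 where f0: "conic_frame u0 v0 w0 \<xi>0 \<eta>0 \<zeta>0"
    and qf0: "\<And>a b c. qform q (a *s u0 + b *s v0 + c *s w0) = a * c - b\<^sup>2"
    using conic_frame_exists[OF smooth w0] by metis
  interpret F0: conic_frame u0 v0 w0 \<xi>0 \<eta>0 \<zeta>0 by (rule f0)
  have "infinite (range (\<lambda>\<tau>. vec.span {F0.pt \<tau>}))"
    using finite_imageD[OF _ F0.inj_span_pt] infinite_UNIV_char_0 by blast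
  then have "\<not> range (\<lambda>\<tau>. vec.span {F0.pt \<tau>}) \<subseteq> S" using S(2) finite_subset by blast
  then obtain \<sigma> where \<sigma>: "vec.span {F0.pt \<sigma>} \<notin> S" by blast
  define w where "w = F0.pt \<sigma>"
  have w: "w \<noteq> 0" "qform q w = 0"
    using F0.pt_nonzero qf0[of 1 \<sigma> "\<sigma>\<^sup>2"] by (simp_all add: w_def F0.pt_def)
  obtain u v \<xi> \<eta> \<zeta> where f: "conic_frame u v w \<xi> \<eta> \<zeta>"
    and qf: "\<And>a b c. qform q (a *s u + b *s v + c *s w) = a * c - b\<^sup>2"
    using conic_frame_exists[OF smooth w] by metis
  interpret F: conic_frame u v w \<xi> \<eta> \<zeta> by (rule f)
  have "\<exists>\<tau>. P = vec.span {F.pt \<tau>}" if P: "P \<in> S" for P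
  proof -
    from P S obtain x where x: "x \<noteq> 0" "qform q x = 0" "P = vec.span {x}" using C_E by blast
    define a b c where "a = dot \<xi> x" and "b = dot \<eta> x" and "c = dot \<zeta> x"
    have xe: "x = a *s u + b *s v + c *s w"
    proof (unfold vec_eq_iff, rule allI)
      fix i
      have "x $ i = (\<Sum>j\<in>UNIV. (u $ i * \<xi> $ j + v $ i * \<eta> $ j + w $ i * \<zeta> $ j) * x $ j)"
        unfolding F.resolution by (simp add: if_distrib[of "\<lambda>y. y * _"] cong: if_cong)
      also have "\<dots> = (a *s u + b *s v + c *s w) $ i"
        unfolding vector_add_component vector_smult_component a_def b_def c_def dot_def
          sum_distrib_right sum.distrib[symmetric]
        by (intro sum.cong refl) (simp add: algebra_simps)
      finally show "x $ i = (a *s u + b *s v + c *s w) $ i" .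
    qed
    have abc: "a * c = b\<^sup>2" using x(2) qf xe by simp
    \<comment> \<open>If \<open>a\<close> were 0, the equation of the conic would give
      \<open>b = 0\<close>, and the point would be infinity, which is not in
      \<open>S\<close>.\<close>
    have "a \<noteq> 0"
    proof
      assume "a = 0"
      with abc xe have "x = c *s w" by simp
      with x \<sigma> P show False by (metis span_scale_eq w_def vec.scale_zero_left)
    qed
    then have "x = a *s F.pt (b / a)"
      using abc unfolding xe F.pt_def by (simp add: vec_eq_iff field_simps power2_eq_square)
    then have "P = vec.span {F.pt (b / a)}" using x(3) span_scale_eq[OF \<open>a \<noteq> 0\<close>] by simp
    then show ?thesis by blast
  qed
  then show thesis using that[OF f] by blast
qed

theorem corollary5p3:
  fixes S C :: "('k::{alg_closed_field, field_char_0} ^ 3) set set"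
    and n m t :: nat
  assumes "n \<ge> 5" and "odd n"
    and "smooth_conic C"
    and "S \<subseteq> C" and "finite S" and "card S = n"
    and "m \<ge> 1" and "t \<ge> 1"
  shows "symbolic_power S (t * (m + 1))
           \<subseteq> ideal_power irrelevant_ideal t \<cdot>\<^bsub>coord_ring\<^esub> ideal_power (symbolic_power S m) t \<and>
         symbolic_power S (t * (m + 1) - 1)
           \<subseteq> ideal_power (symbolic_power S m) t \<and>
         symbolic_power S (t * (m + 1) - 1)
           \<subseteq> ideal_power irrelevant_ideal (t - 1) \<cdot>\<^bsub>coord_ring\<^esub> ideal_power (symbolic_power S m) t"
proof -
  from \<open>odd n\<close> obtain l where n: "n = 2 * l + 1" by (elim oddE)
  have "S \<noteq> {}" using assms(1,6) by auto
  then obtain u v w \<xi> \<eta> \<zeta> where f: "conic_frame u v w \<xi> \<eta> \<zeta>"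
    and pt: "\<And>P. P \<in> S \<Longrightarrow> \<exists>\<tau>. P = vec.span {conic_frame.pt u v w \<tau>}"
    using smooth_conic_frame[OF assms(3-5)] by metis
  interpret F: conic_frame u v w \<xi> \<eta> \<zeta> by (rule f)
  have "{0..<card S} = {..2 * l}" using assms(6) n by auto
  then obtain h where h: "bij_betw h {..2 * l} S"
    using ex_bij_betw_nat_finite[OF \<open>finite S\<close>] by metis
  have "\<forall>i\<in>{..2 * l}. \<exists>\<tau>. h i = vec.span {F.pt \<tau>}"
    using h pt bij_betwE by blast
  then obtain \<tau> where \<tau>: "\<forall>i\<in>{..2 * l}. h i = vec.span {F.pt (\<tau> i)}"
    by (rule bchoice[THEN exE])
  \<comment> \<open>Equal parameters would give equal points, but \<open>h\<close> enumerates
    \<open>S\<close> without repetition.\<close>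
  have "inj_on \<tau> {..2 * l}"
    using bij_betw_imp_inj_on[OF h] \<tau> by (auto simp: inj_on_def)
  then interpret P: conic_points u v w \<xi> \<eta> \<zeta> l \<tau>
    using assms(1) n by unfold_locales auto
  have "P.pts = h ` {..2 * l}" unfolding P.pts_def using \<tau> by auto
  then have "P.pts = S" using bij_betw_imp_surj_on[OF h] by simp
  then show ?thesis
    using P.symb_containment[OF assms(7,8)] P.T_subset_power[of m "t - 1" t]
    unfolding P.T_def by auto
qed

end
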